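(* Let $G$ be an infinite group and let $X$ be a nonempty strongly irreducible $G$-subshift. Then the center $Z(\operatorname{Aut}(X))$ of the automorphism group of $X$ is generated by the shifts $\tau_g$ by elements $g\in G$ with $g\operatorname{Fix}(X)\in Z(G/\operatorname{Fix}(X))$. In particular, $Z(\operatorname{Aut}(X))\cong Z(G/\operatorname{Fix}(X))$.
   Context: Let $A$ be a finite set (alphabet) and $G$ a (discrete) group. $A^G=\{x\colon G\to A\}$ carries the prodiscrete topology and the left shift action $(gx)(h)=x(g^{-1}h)$. A $G$-subshift is a closed, shift-invariant subset $X\subset A^G$ for some finite alphabet $A$. For finite $F\subset G$, $L_F(X)=\{x|_F : x\in X\}$. $X$ is strongly irreducible if there is a finite $K\subset G$ (a strong irreducibility constant) such that whenever $S,T\subset G$ are finite with $SK\cap T=\varnothing$, for every $p\in L_S(X)$ and $q\in L_T(X)$ there is $x\in X$ with $x|_S=p$ and $x|_T=q$. $\operatorname{Aut}(X)$ is the group of all $G$-equivariant homeomorphisms $X\to X$ under composition. $\operatorname{Fix}(X)=\{g\in G: gx=x \text{ for all } x\in X\}$, a normal subgroup of $G$. $Z(\cdot)$ denotes the center of a group. The (right) shift by $g$ is $\tau_g(x)(h)=x(hg)$; when $g\operatorname{Fix}(X)\in Z(G/\operatorname{Fix}(X))$ it satisfies $\tau_g(x)=g^{-1}x$ for $x\in X$, and it is regarded as a map $X\to X$. *)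

theory Defs
  imports "HOL-Analysis.Analysis" "HOL-Algebra.Bij" "HOL-Algebra.Coset" "HOL-Algebra.Generated_Groups"
begin

(* Configurations are extensional functions on carrier G, so that equality of
   configurations is equality of their values on the group. *)
definition prodiscrete :: "('g, 'm) monoid_scheme \<Rightarrow> 'a set \<Rightarrow> ('g \<Rightarrow> 'a) topology" where
  "prodiscrete G A = product_topology (\<lambda>_. discrete_topology A) (carrier G)"

definition lshift :: "('g, 'm) monoid_scheme \<Rightarrow> 'g \<Rightarrow> ('g \<Rightarrow> 'a) \<Rightarrow> 'g \<Rightarrow> 'a" where
  "lshift G g x = (\<lambda>h\<in>carrier G. x (inv\<^bsub>G\<^esub> g \<otimes>\<^bsub>G\<^esub> h))"

definition rshift :: "('g, 'm) monoid_scheme \<Rightarrow> 'g \<Rightarrow> ('g \<Rightarrow> 'a) \<Rightarrow> 'g \<Rightarrow> 'a" where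
  "rshift G g x = (\<lambda>h\<in>carrier G. x (h \<otimes>\<^bsub>G\<^esub> g))"

definition subshift :: "('g, 'm) monoid_scheme \<Rightarrow> 'a set \<Rightarrow> ('g \<Rightarrow> 'a) set \<Rightarrow> bool" where
  "subshift G A X \<longleftrightarrow>
     closedin (prodiscrete G A) X \<and> (\<forall>g\<in>carrier G. \<forall>x\<in>X. lshift G g x \<in> X)"

definition patterns :: "'g set \<Rightarrow> ('g \<Rightarrow> 'a) set \<Rightarrow> ('g \<Rightarrow> 'a) set" where
  "patterns F X = (\<lambda>x. restrict x F) ` X"

definition strongly_irreducible :: "('g, 'm) monoid_scheme \<Rightarrow> ('g \<Rightarrow> 'a) set \<Rightarrow> bool" where
  "strongly_irreducible G X \<longleftrightarrow>
     (\<exists>K. finite K \<and> K \<subseteq> carrier G \<and>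
        (\<forall>S T. finite S \<and> S \<subseteq> carrier G \<and> finite T \<and> T \<subseteq> carrier G \<and>
               (S <#>\<^bsub>G\<^esub> K) \<inter> T = {} \<longrightarrow>
           (\<forall>p\<in>patterns S X. \<forall>q\<in>patterns T X.
              \<exists>x\<in>X. restrict x S = p \<and> restrict x T = q)))"

definition Aut_shift ::
    "('g, 'm) monoid_scheme \<Rightarrow> 'a set \<Rightarrow> ('g \<Rightarrow> 'a) set \<Rightarrow> (('g \<Rightarrow> 'a) \<Rightarrow> 'g \<Rightarrow> 'a) monoid" where
  "Aut_shift G A X = BijGroup X \<lparr>carrier :=
     {f \<in> Bij X.
        homeomorphic_map (subtopology (prodiscrete G A) X) (subtopology (prodiscrete G A) X) f \<and>
        (\<forall>g\<in>carrier G. \<forall>x\<in>X. f (lshift G g x) = lshift G g (f x))}\<rparr>"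

definition Fix_shift :: "('g, 'm) monoid_scheme \<Rightarrow> ('g \<Rightarrow> 'a) set \<Rightarrow> 'g set" where
  "Fix_shift G X = {g \<in> carrier G. \<forall>x\<in>X. lshift G g x = x}"

definition group_center :: "('g, 'm) monoid_scheme \<Rightarrow> 'g set" where
  "group_center G = {z \<in> carrier G. \<forall>y\<in>carrier G. z \<otimes>\<^bsub>G\<^esub> y = y \<otimes>\<^bsub>G\<^esub> z}"

end

theory Submission
  imports Defs "HOL-Real_Asymp.Real_Asymp"
begin

text \<open>
  Let \<open>X\<close> have at least two points. Among the patterns \<open>w\<close> on finite sets \<open>B\<close> disjoint from a fixed
  finite \<open>S \<supseteq> K\<close>, choose one whose set of fillings of \<open>S\<close> cannot be shrunk by extending \<open>w\<close>. Then in
  every point of \<open>X\<close> showing \<open>w\<close> the filling may be replaced by any other one without leaving \<open>X\<close>,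
  although \<open>X\<close> need not be of finite type, and exchanging two fillings at all sufficiently isolated
  occurrences of \<open>w\<close> is an automorphism. A counting argument over sparse extensions of \<open>w\<close> shows
  that isolated occurrences exist for extensions of a prescribed pattern.

  A central \<open>f\<close> commutes with these exchanges, so \<open>f\<close> moves an isolated occurrence of \<open>w\<close> by an
  element of a finite set \<open>Q\<close> that does not depend on \<open>w\<close>. If every \<open>a \<in> Q\<close> violated \<open>f x (a h) = x h\<close> for
  infinitely many \<open>h\<close>, one violation for each \<open>a\<close> could be glued into \<open>w\<close>, a contradiction. Hence
  \<open>f x (a h) = x h\<close> for one \<open>a\<close> and all but finitely many \<open>h\<close>, and equivariance upgrades this to:
  \<open>a\<close> is central modulo \<open>Fix X\<close> and \<open>f x = a x\<close>.
\<close>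

section \<open>Subshifts and block maps\<close>

text \<open>The obstacle is isolation: copies of \<open>w\<close> with overlapping supports must be
  prevented from occurring together. Counting separates \<open>w\<close> from its translate by
  \<open>e\<close> only if some cell \<open>e \<rho> i\<close> lies away from the cells already
  fixed, so that its letter can be prescribed independently. This may fail for
  \<open>e = y k y^-1\<close> with \<open>k \<in> K\<close>, since \<open>e \<rho> i\<close> can
  equal \<open>\<rho> i k\<close> for all \<open>i\<close>. These exceptional \<open>e\<close> form
  a finite set that depends on \<open>K\<close> and \<open>y\<close> but not on \<open>w\<close>, so
  they are broken beforehand by cells glued into \<open>w\<close>. Elements of the kernel
  \<open>N\<close> cannot be broken by any point of \<open>X\<close>, so occurrences are determined
  only modulo \<open>N\<close>; this is harmless because \<open>N\<close> is contained in
  \<open>K\<close> and hence finite. Both facts dictate \<open>S = N K\<close>: left invariance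
  under \<open>N\<close> makes the support \<open>g S\<close> depend only on the coset
  \<open>g N\<close>, and \<open>K \<subseteq> S\<close> leaves the letter at \<open>\<one>\<close>
  free whatever stands outside \<open>S\<close>, so that a second filling always exists.\<close>

locale shift_space = group G for G :: "('g, 'm) monoid_scheme" (structure) +
  fixes A :: "'a set" and X :: "('g \<Rightarrow> 'a) set"
  assumes finite_alphabet: "finite A" and subshift: "subshift G A X"
begin

lemma mult_inv_cancel [simp]:
  "g \<in> carrier G \<Longrightarrow> h \<in> carrier G \<Longrightarrow> g \<otimes> (inv g \<otimes> h) = h"
  "g \<in> carrier G \<Longrightarrow> h \<in> carrier G \<Longrightarrow> inv g \<otimes> (g \<otimes> h) = h"
  by (simp_all flip: m_assoc)

lemmas gsimps = m_assoc inv_mult_group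

abbreviation N :: "'g set" where "N \<equiv> Fix_shift G X"

lemma closedin_X: "closedin (prodiscrete G A) X"
  using subshift by (simp add: subshift_def)

lemma topspace_prodiscrete: "topspace (prodiscrete G A) = carrier G \<rightarrow>\<^sub>E A"
  by (simp add: prodiscrete_def)

lemma X_subset: "X \<subseteq> carrier G \<rightarrow>\<^sub>E A"
  using closedin_subset[OF closedin_X] by (simp add: topspace_prodiscrete)

lemma X_eqI:
  assumes "x \<in> X" "y \<in> X" "\<And>t. t \<in> carrier G \<Longrightarrow> x t = y t"
  shows "x = y"
  using X_subset assms by (meson PiE_ext subsetD)

lemma lshift_in_X: "g \<in> carrier G \<Longrightarrow> x \<in> X \<Longrightarrow> lshift G g x \<in> X"
  using subshift by (simp add: subshift_def)

lemma lshift_apply: "h \<in> carrier G \<Longrightarrow> lshift G g x h = x (inv g \<otimes> h)"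
  by (simp add: lshift_def)

lemma lshift_inv_apply: "g \<in> carrier G \<Longrightarrow> h \<in> carrier G \<Longrightarrow> lshift G (inv g) x h = x (g \<otimes> h)"
  by (simp add: lshift_def)

lemma lshift_mult:
  assumes "g \<in> carrier G" "h \<in> carrier G"
  shows "lshift G (g \<otimes> h) x = lshift G g (lshift G h x)"
  using assms by (auto simp: lshift_def inv_mult_group m_assoc intro!: restrict_ext)

lemma lshift_one: "x \<in> X \<Longrightarrow> lshift G \<one> x = x"
  using lshift_in_X[of \<one> x] by (intro X_eqI) (auto simp: lshift_apply)

lemma lshift_inv_lshift:
  "g \<in> carrier G \<Longrightarrow> x \<in> X \<Longrightarrow> lshift G (inv g) (lshift G g x) = x"
  by (simp add: lshift_one flip: lshift_mult)

lemma lshift_lshift_inv: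
  "g \<in> carrier G \<Longrightarrow> x \<in> X \<Longrightarrow> lshift G g (lshift G (inv g) x) = x"
  by (simp add: lshift_one flip: lshift_mult)

section \<open>The kernel of the shift action\<close>

lemma N_carrier: "n \<in> N \<Longrightarrow> n \<in> carrier G"
  by (simp add: Fix_shift_def)

lemma N_iff: "n \<in> N \<longleftrightarrow> n \<in> carrier G \<and> (\<forall>x\<in>X. \<forall>t\<in>carrier G. x (n \<otimes> t) = x t)"
proof -
  have "lshift G n x = x \<longleftrightarrow> (\<forall>t\<in>carrier G. x (n \<otimes> t) = x t)"
    if n: "n \<in> carrier G" and x: "x \<in> X" for x
  proof
    assume "lshift G n x = x"
    then show "\<forall>t\<in>carrier G. x (n \<otimes> t) = x t"
      using n lshift_apply[of "n \<otimes> _" n x] by simp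
  next
    assume *: "\<forall>t\<in>carrier G. x (n \<otimes> t) = x t"
    show "lshift G n x = x"
    proof (rule X_eqI)
      fix t assume t: "t \<in> carrier G"
      have "x (n \<otimes> (inv n \<otimes> t)) = x (inv n \<otimes> t)" using * n t by (metis inv_closed m_closed)
      then show "lshift G n x t = x t"
        using n t by (simp add: lshift_apply)
    qed (use n x lshift_in_X in auto)
  qed
  then show ?thesis by (auto simp: Fix_shift_def)
qed

lemma N_apply: "n \<in> N \<Longrightarrow> x \<in> X \<Longrightarrow> t \<in> carrier G \<Longrightarrow> x (n \<otimes> t) = x t"
  by (simp add: N_iff)

lemma subgroup_N: "subgroup N G"
proof
  show "inv n \<in> N" if "n \<in> N" for n
  proof -
    have "lshift G (inv n) x = x" if "x \<in> X" for x
      using lshift_inv_lshift[of n x] \<open>n \<in> N\<close> that by (simp add: Fix_shift_def)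
    then show ?thesis using that by (simp add: Fix_shift_def)
  qed
  show "m \<otimes> n \<in> N" if "m \<in> N" "n \<in> N" for m n
    using that by (auto simp: Fix_shift_def lshift_mult)
qed (auto simp: Fix_shift_def lshift_one)

lemma conj_in_N: "g \<in> carrier G \<Longrightarrow> n \<in> N \<Longrightarrow> g \<otimes> n \<otimes> inv g \<in> N"
  by (auto simp: Fix_shift_def lshift_mult lshift_in_X lshift_lshift_inv)

lemma normal_N: "N \<lhd> G"
  using subgroup_N conj_in_N by (simp add: normal_inv_iff)

text \<open>Normality turns the \<open>n\<close> between \<open>g\<close> and \<open>t\<close> into
  an element of \<open>N\<close> in front. Markers placed at \<open>g\<close> and at
  \<open>g \<otimes> n\<close> therefore read the same values.\<close>

lemma N_apply_right:
  assumes "n \<in> N" "x \<in> X" "g \<in> carrier G" "t \<in> carrier G"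
  shows "x (g \<otimes> n \<otimes> t) = x (g \<otimes> t)"
proof -
  have "g \<otimes> n \<otimes> t = (g \<otimes> n \<otimes> inv g) \<otimes> (g \<otimes> t)"
    using assms N_carrier by (simp add: gsimps)
  then show ?thesis
    using N_apply[OF conj_in_N, of g n x "g \<otimes> t"] assms by simp
qed

section \<open>Cylinders, closedness and local rules\<close>

lemma openin_cylinder:
  assumes "finite W" "W \<subseteq> carrier G" "x \<in> X"
  shows "openin (prodiscrete G A) {y \<in> carrier G \<rightarrow>\<^sub>E A. \<forall>t\<in>W. y t = x t}"
proof -
  have "{y \<in> carrier G \<rightarrow>\<^sub>E A. \<forall>t\<in>W. y t = x t} = (\<Pi>\<^sub>E t\<in>carrier G. if t \<in> W then {x t} else A)"
    
    (is "?L = ?R")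
  proof (rule Set.set_eqI)
    fix y
    have "x t \<in> A" if "t \<in> W" for t
      using assms X_subset that by (auto simp: PiE_iff)
    then show "y \<in> ?L \<longleftrightarrow> y \<in> ?R"
      using assms(2) by (auto simp: PiE_iff subset_iff split: if_splits)
  qed
  moreover have "openin (prodiscrete G A) (\<Pi>\<^sub>E t\<in>carrier G. if t \<in> W then {x t} else A)"
  proof -
    have "finite {t \<in> carrier G. (if t \<in> W then {x t} else A) \<noteq> A}"
      by (rule finite_subset[OF _ assms(1)]) auto
    moreover have "x t \<in> A" if "t \<in> carrier G" for t
      using assms(3) X_subset that by (auto simp: PiE_iff)
    ultimately show ?thesis
      unfolding prodiscrete_def openin_PiE_gen by auto
  qed
  ultimately show ?thesis by simp
qed

lemma in_open_cylinder:
  assumes "openin (prodiscrete G A) U" "x \<in> U"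
  obtains W where "finite W" "W \<subseteq> carrier G"
    "\<forall>y\<in>carrier G \<rightarrow>\<^sub>E A. (\<forall>t\<in>W. y t = x t) \<longrightarrow> y \<in> U"
proof -
  obtain V where V: "finite {i \<in> carrier G. V i \<noteq> A}" "x \<in> Pi\<^sub>E (carrier G) V" "Pi\<^sub>E (carrier G) V \<subseteq> U"
    using assms unfolding prodiscrete_def openin_product_topology_alt by auto
  show ?thesis
  proof
    show "finite {i \<in> carrier G. V i \<noteq> A}" by (fact V(1))
    show "\<forall>y\<in>carrier G \<rightarrow>\<^sub>E A. (\<forall>t\<in>{i \<in> carrier G. V i \<noteq> A}. y t = x t) \<longrightarrow> y \<in> U"
    proof (intro ballI impI)
      fix y assume y: "y \<in> carrier G \<rightarrow>\<^sub>E A" and eq: "\<forall>t\<in>{i \<in> carrier G. V i \<noteq> A}. y t = x t"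
      have "y t \<in> V t" if "t \<in> carrier G" for t
        using y eq V(2) that by (cases "V t = A") (auto simp: PiE_iff)
      then have "y \<in> Pi\<^sub>E (carrier G) V" using y by (simp add: PiE_iff)
      then show "y \<in> U" using V(3) by blast
    qed
  qed auto
qed

text \<open>A cylinder around \<open>x\<close> missing the closed set \<open>X\<close> would
  contradict \<open>loc\<close> on its finite support. This is how configurations with infinitely
  many local changes are shown to lie in \<open>X\<close>.\<close>

lemma in_X_if_locally_in_X:
  assumes x: "x \<in> carrier G \<rightarrow>\<^sub>E A"
    and loc: "\<And>W. finite W \<Longrightarrow> W \<subseteq> carrier G \<Longrightarrow> \<exists>y\<in>X. \<forall>t\<in>W. y t = x t"
  shows "x \<in> X"
proof (rule ccontr)
  assume "x \<notin> X"
  then have 1: "x \<in> topspace (prodiscrete G A) - X" using x by (simp add: topspace_prodiscrete)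
  have 2: "openin (prodiscrete G A) (topspace (prodiscrete G A) - X)"
    using closedin_X by (simp add: openin_diff)
  obtain W where W: "finite W" "W \<subseteq> carrier G"
    "\<forall>y\<in>carrier G \<rightarrow>\<^sub>E A. (\<forall>t\<in>W. y t = x t) \<longrightarrow> y \<in> topspace (prodiscrete G A) - X"
    by (rule in_open_cylinder[OF 2 1])
  obtain y where "y \<in> X" "\<forall>t\<in>W. y t = x t" using loc[OF W(1,2)] by blast
  then show False using W(3) X_subset by blast
qed

abbreviation TX :: "('g \<Rightarrow> 'a) topology" where
  "TX \<equiv> subtopology (prodiscrete G A) X"

lemma topspace_TX: "topspace TX = X"
  using X_subset by (auto simp: topspace_prodiscrete)

text \<open>The window may depend on \<open>x\<close> and \<open>t\<close>: it makes each coordinate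
  preimage a union of cylinders, and continuity into a product is checked coordinatewise.\<close>

lemma continuous_mapI_local:
  assumes f: "f \<in> X \<rightarrow> X"
    and loc: "\<And>x t. x \<in> X \<Longrightarrow> t \<in> carrier G \<Longrightarrow>
      \<exists>W. finite W \<and> W \<subseteq> carrier G \<and> (\<forall>y\<in>X. (\<forall>s\<in>W. y s = x s) \<longrightarrow> f y t = f x t)"
  shows "continuous_map TX TX f"
proof (rule continuous_map_into_subtopology)
  have fA: "f x \<in> carrier G \<rightarrow>\<^sub>E A" if "x \<in> X" for x using f X_subset that by blast
  show "f \<in> topspace TX \<rightarrow> X" using f topspace_TX by simp
  have "continuous_map TX (discrete_topology A) (\<lambda>x. f x t)" if t: "t \<in> carrier G" for t
    unfolding continuous_map_def
  proof (intro conjI allI impI)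
    show "(\<lambda>x. f x t) \<in> topspace TX \<rightarrow> topspace (discrete_topology A)"
      using fA t unfolding topspace_TX by (auto simp: PiE_iff)
    fix U
    let ?P = "{x \<in> topspace TX. f x t \<in> U}"
    show "openin TX ?P"
    proof (subst openin_subopen, intro ballI)
      fix x assume x: "x \<in> ?P"
      then have xX: "x \<in> X" and xU: "f x t \<in> U" by (simp_all only: topspace_TX mem_Collect_eq)
      obtain W where W: "finite W" "W \<subseteq> carrier G" "\<forall>y\<in>X. (\<forall>s\<in>W. y s = x s) \<longrightarrow> f y t = f x t"
        using loc[OF xX t] by blast
      have *: "openin TX ({y \<in> carrier G \<rightarrow>\<^sub>E A. \<forall>t\<in>W. y t = x t} \<inter> X)"
        using openin_cylinder[OF W(1,2) xX] by (rule openin_subtopology_Int)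
      show "\<exists>T. openin TX T \<and> x \<in> T \<and> T \<subseteq> ?P"
      proof (rule exI, intro conjI, rule *)
        show "x \<in> {y \<in> carrier G \<rightarrow>\<^sub>E A. \<forall>t\<in>W. y t = x t} \<inter> X" using xX X_subset by blast
        have "f y t \<in> U" if "y \<in> X" "\<forall>s\<in>W. y s = x s" for y
        proof -
          have "f y t = f x t" using W(3) that by blast
          then show ?thesis using xU by simp
        qed
        then show "{y \<in> carrier G \<rightarrow>\<^sub>E A. \<forall>t\<in>W. y t = x t} \<inter> X \<subseteq> ?P"
          unfolding topspace_TX by (intro subsetI) simp
      qed
    qed
  qed
  moreover have "f ` topspace TX \<subseteq> extensional (carrier G)"
    using fA unfolding topspace_TX by (auto simp: PiE_iff)
  ultimately show "continuous_map TX (prodiscrete G A) f"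
    unfolding prodiscrete_def continuous_map_componentwise by blast
qed

text \<open>Curtis-Hedlund-Lyndon: continuity gives a window for the coordinate
  \<open>\<one>\<close> at each point, compactness makes it uniform, and equivariance carries it to
  \<open>t\<close> as \<open>t \<otimes> m\<close>.\<close>

lemma memory_set:
  assumes cont: "continuous_map TX TX f"
    and equiv: "\<And>g x. g \<in> carrier G \<Longrightarrow> x \<in> X \<Longrightarrow> f (lshift G g x) = lshift G g (f x)"
  obtains M where "finite M" "M \<subseteq> carrier G"
    "\<And>x y t. x \<in> X \<Longrightarrow> y \<in> X \<Longrightarrow> t \<in> carrier G \<Longrightarrow> (\<And>m. m \<in> M \<Longrightarrow> x (t \<otimes> m) = y (t \<otimes> m)) \<Longrightarrow> f x t = f y t"
proof -
  have f: "f x \<in> X" if "x \<in> X" for x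
    using continuous_map_image_subset_topspace[OF cont] that unfolding topspace_TX by blast
  have cont1: "continuous_map TX (discrete_topology A) (\<lambda>x. f x \<one>)"
    using cont unfolding continuous_map_in_subtopology prodiscrete_def continuous_map_componentwise
    by blast
  have "\<exists>W. finite W \<and> W \<subseteq> carrier G \<and> (\<forall>y\<in>X. (\<forall>s\<in>W. y s = x s) \<longrightarrow> f y \<one> = f x \<one>)"
    if x: "x \<in> X" for x
  proof -
    have "f x \<one> \<in> A" using f[OF x] X_subset by (auto simp: PiE_iff)
    then have "openin TX {y \<in> topspace TX. f y \<one> \<in> {f x \<one>}}"
      using cont1 by (intro openin_continuous_map_preimage) auto
    then obtain U where U: "openin (prodiscrete G A) U" "{y \<in> X. f y \<one> = f x \<one>} = U \<inter> X"
      unfolding topspace_TX openin_subtopology by auto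
    then have "x \<in> U" using x by blast
    then obtain W where W: "finite W" "W \<subseteq> carrier G"
      "\<forall>y\<in>carrier G \<rightarrow>\<^sub>E A. (\<forall>t\<in>W. y t = x t) \<longrightarrow> y \<in> U"
      by (rule in_open_cylinder[OF U(1)])
    have "f y \<one> = f x \<one>" if "y \<in> X" "\<forall>s\<in>W. y s = x s" for y
    proof -
      have "y \<in> U \<inter> X" using that X_subset W(3) by blast
      then show ?thesis unfolding U(2)[symmetric] by simp
    qed
    then show ?thesis using W(1,2) by blast
  qed
  then obtain W where W: "\<And>x. x \<in> X \<Longrightarrow> finite (W x) \<and> W x \<subseteq> carrier G"
    "\<And>x y. x \<in> X \<Longrightarrow> y \<in> X \<Longrightarrow> (\<And>s. s \<in> W x \<Longrightarrow> y s = x s) \<Longrightarrow> f y \<one> = f x \<one>"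
    by metis
  define C where "C x = {y \<in> carrier G \<rightarrow>\<^sub>E A. \<forall>t\<in>W x. y t = x t}" for x
  have "compact_space (prodiscrete G A)"
    by (simp add: prodiscrete_def compact_space_product_topology compact_space_discrete_topology
      finite_alphabet)
  then have "compactin (prodiscrete G A) X"
    using closedin_X closedin_compact_space by blast
  moreover have "openin (prodiscrete G A) U" if "U \<in> C ` X" for U
    using that openin_cylinder W(1) unfolding C_def by auto
  moreover have "X \<subseteq> \<Union> (C ` X)"
    using X_subset unfolding C_def by auto
  ultimately obtain F where F: "finite F" "F \<subseteq> C ` X" "X \<subseteq> \<Union>F"
    by (meson compactinD)
  then obtain Y where Y: "finite Y" "Y \<subseteq> X" "F = C ` Y"
    by (meson finite_subset_image)
  \<comment> \<open>If \<open>x\<close> lies in the cylinder of \<open>u \<in> Y\<close> and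
    \<open>y\<close> agrees with \<open>x\<close> on this union, then both agree with
    \<open>u\<close> on \<open>W u\<close>.\<close>
  define M where "M = (\<Union>x\<in>Y. W x)"
  have one: "f x \<one> = f y \<one>" if xy: "x \<in> X" "y \<in> X" and eq: "\<And>m. m \<in> M \<Longrightarrow> x m = y m" for x y
  proof -
    obtain u where u: "u \<in> Y" "x \<in> C u" using F Y xy by blast
    have "u \<in> X" using u Y by blast
    have xu: "\<And>s. s \<in> W u \<Longrightarrow> x s = u s" using u by (auto simp: C_def)
    moreover have "y s = u s" if "s \<in> W u" for s
    proof -
      have "s \<in> M" using that u(1) by (auto simp: M_def)
      then show ?thesis using eq xu[OF that] by metis
    qed
    ultimately show ?thesis using W(2)[OF \<open>u \<in> X\<close>] xy by metis
  qed
  show ?thesis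
  proof
    show "finite M" "M \<subseteq> carrier G" using Y W(1) by (auto simp: M_def)
    then have M: "m \<in> carrier G" if "m \<in> M" for m using that by blast
    fix x y t
    assume xy: "x \<in> X" "y \<in> X" and t: "t \<in> carrier G"
      and eq: "\<And>m. m \<in> M \<Longrightarrow> x (t \<otimes> m) = y (t \<otimes> m)"
    have "f (lshift G (inv t) x) \<one> = f (lshift G (inv t) y) \<one>"
      by (rule one) (use xy t eq M in \<open>auto simp: lshift_in_X lshift_inv_apply\<close>)
    then show "f x t = f y t"
      using xy t equiv[of "inv t"] by (simp add: lshift_inv_apply)
  qed
qed

end

section \<open>Strongly irreducible subshifts\<close>

text \<open>\<open>glue\<close> is strong irreducibility in pointwise form;
  \<open>\<one> \<in> K\<close> makes \<open>P\<close> and \<open>T\<close> disjoint there. A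
  one-point \<open>X\<close> is treated separately in \<open>theorem1\<close>.\<close>

locale si_shift = shift_space G A X
  for G :: "('g, 'm) monoid_scheme" (structure) and A :: "'a set" and X :: "('g \<Rightarrow> 'a) set" +
  fixes K :: "'g set"
  assumes infinite_G: "infinite (carrier G)"
    and finite_K: "finite K" and K_carrier: "K \<subseteq> carrier G" and one_in_K: "\<one> \<in> K"
    and glue: "\<And>P T x y. finite P \<Longrightarrow> P \<subseteq> carrier G \<Longrightarrow> finite T \<Longrightarrow> T \<subseteq> carrier G \<Longrightarrow>
      (\<And>s k. s \<in> P \<Longrightarrow> k \<in> K \<Longrightarrow> s \<otimes> k \<notin> T) \<Longrightarrow> x \<in> X \<Longrightarrow> y \<in> X \<Longrightarrow>
      \<exists>z\<in>X. (\<forall>t\<in>P. z t = x t) \<and> (\<forall>t\<in>T. z t = y t)"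
    and nontrivial: "\<exists>x\<in>X. \<exists>y\<in>X. x \<noteq> y"
begin

lemma two_letters:
  obtains x y where "x \<in> X" "y \<in> X" "x \<one> \<noteq> y \<one>"
proof -
  obtain x y where xy: "x \<in> X" "y \<in> X" "x \<noteq> y" using nontrivial by blast
  then obtain t where t: "t \<in> carrier G" "x t \<noteq> y t" using X_eqI by blast
  show thesis
    by (rule that[of "lshift G (inv t) x" "lshift G (inv t) y"])
      (use xy t in \<open>simp_all add: lshift_in_X lshift_inv_apply\<close>)
qed

text \<open>For \<open>u\<close> outside \<open>K\<close>, different letters could be glued at
  \<open>\<one>\<close> and at \<open>u\<close>.\<close>

lemma right_stabilizer_subset_K:
  assumes u: "u \<in> carrier G" and fixed: "\<And>x t. x \<in> X \<Longrightarrow> t \<in> carrier G \<Longrightarrow> x (t \<otimes> u) = x t"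
  shows "u \<in> K"
proof (rule ccontr)
  assume "u \<notin> K"
  obtain x y where xy: "x \<in> X" "y \<in> X" "x \<one> \<noteq> y \<one>" by (rule two_letters)
  have "\<exists>z\<in>X. (\<forall>t\<in>{\<one>}. z t = x t) \<and> (\<forall>t\<in>{u}. z t = lshift G u y t)"
    by (rule glue) (use u xy K_carrier \<open>u \<notin> K\<close> lshift_in_X in auto)
  then obtain z where "z \<in> X" "z \<one> = x \<one>" "z u = lshift G u y u" by auto
  then show False
    using fixed[of z \<one>] xy u by (simp add: lshift_apply)
qed

lemma N_subset_K: "N \<subseteq> K"
proof
  fix n assume n: "n \<in> N"
  show "n \<in> K"
  proof (rule right_stabilizer_subset_K)
    show "n \<in> carrier G" using n by (rule N_carrier)
    show "x (t \<otimes> n) = x t" if "x \<in> X" "t \<in> carrier G" for x t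
      using N_apply_right[OF n that(1), of t \<one>] that n N_carrier by simp
  qed
qed

lemma finite_N: "finite N"
  using N_subset_K finite_K by (rule finite_subset)

text \<open>All but finitely many conjugates of \<open>v\<close> lie in the finite right stabilizer of \<open>X\<close>; by
  pigeonhole the centralizer of \<open>v\<close> is infinite, so every conjugate is among these.\<close>
lemma N_if_cofinitely_fixed:
  assumes v: "v \<in> carrier G" and fin: "finite E"
    and fixed: "\<And>x t. x \<in> X \<Longrightarrow> t \<in> carrier G \<Longrightarrow> t \<notin> E \<Longrightarrow> x (v \<otimes> t) = x t"
  shows "v \<in> N"
proof -
  define P where "P = {u \<in> carrier G. \<forall>x\<in>X. \<forall>t\<in>carrier G. x (t \<otimes> u) = x t}"
  define C where "C t = inv t \<otimes> v \<otimes> t" for t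
  have C_carrier: "C t \<in> carrier G" if "t \<in> carrier G" for t using that v by (simp add: C_def)
  have C_in_P: "C t \<in> P" if t: "t \<in> carrier G" "t \<notin> E" for t
  proof -
    have "x (s \<otimes> C t) = x s" if xs: "x \<in> X" "s \<in> carrier G" for x s
    proof -
      \<comment> \<open>This shift carries \<open>s\<close> to \<open>t\<close>, so the hypothesis
        at the single \<open>t\<close> gives right invariance at every \<open>s\<close>.\<close>
      have "lshift G (t \<otimes> inv s) x (v \<otimes> t) = lshift G (t \<otimes> inv s) x t"
        by (rule fixed) (use t xs lshift_in_X in auto)
      then show ?thesis
        using t xs v by (simp add: lshift_apply C_def gsimps)
    qed
    then show ?thesis using C_carrier t by (simp add: P_def)
  qed
  have "P \<subseteq> K" using right_stabilizer_subset_K by (auto simp: P_def)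
  then have "finite P" using finite_K finite_subset by blast
  moreover have "C ` (carrier G - E) \<subseteq> P" using C_in_P by blast
  ultimately have "finite (C ` (carrier G - E))" by (rule rev_finite_subset)
  moreover have "infinite (carrier G - E)" using infinite_G fin by simp
  ultimately obtain t0 where t0: "t0 \<in> carrier G - E"
    and inf: "infinite {t \<in> carrier G - E. C t = C t0}"
    using pigeonhole_infinite by blast
  have "C t \<in> P" if t: "t \<in> carrier G" for t
  proof -
    let ?Y = "{t \<in> carrier G - E. C t = C t0}"
    \<comment> \<open>For \<open>u\<close> in \<open>?Y\<close> the element
      \<open>u \<otimes> (inv t0 \<otimes> t)\<close> conjugates \<open>v\<close> exactly as
      \<open>t\<close> does. There are infinitely many of these, so one avoids
      \<open>E\<close>.\<close>
    have "inj_on (\<lambda>u. u \<otimes> (inv t0 \<otimes> t)) ?Y" using t t0 by (auto intro!: inj_onI)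
    then have "infinite ((\<lambda>u. u \<otimes> (inv t0 \<otimes> t)) ` ?Y)" using inf finite_image_iff by blast
    then obtain u where u: "u \<in> ?Y" "u \<otimes> (inv t0 \<otimes> t) \<notin> E"
      using fin by (meson finite_subset image_subsetI)
    have uG: "u \<in> carrier G" and t0G: "t0 \<in> carrier G" using u t0 by blast+
    have "C (u \<otimes> (inv t0 \<otimes> t)) = inv (inv t0 \<otimes> t) \<otimes> C u \<otimes> (inv t0 \<otimes> t)"
      using uG t t0G v by (simp add: C_def gsimps)
    also have "C u = C t0" using u by simp
    also have "inv (inv t0 \<otimes> t) \<otimes> C t0 \<otimes> (inv t0 \<otimes> t) = C t"
      using t t0G v by (simp add: C_def gsimps)
    finally show ?thesis using C_in_P[of "u \<otimes> (inv t0 \<otimes> t)"] u t t0 by auto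
  qed
  then have "x (v \<otimes> t) = x t" if "x \<in> X" "t \<in> carrier G" for x t
  proof -
    have "x (t \<otimes> C t) = x t" using \<open>\<And>t. t \<in> carrier G \<Longrightarrow> C t \<in> P\<close> that by (simp add: P_def)
    then show ?thesis using that v by (simp add: C_def gsimps)
  qed
  then show ?thesis using v by (simp add: N_iff)
qed

definition S :: "'g set" where "S = (\<lambda>(n, k). n \<otimes> k) ` (N \<times> K)"

lemma finite_S: "finite S"
  by (simp add: S_def finite_N finite_K)

lemma S_carrier: "s \<in> S \<Longrightarrow> s \<in> carrier G"
  using N_carrier K_carrier by (auto simp: S_def)

lemma one_in_N: "\<one> \<in> N"
  using subgroup_N by (rule subgroup.one_closed)

lemma K_subset_S: "K \<subseteq> S"
proof
  fix k assume k: "k \<in> K"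
  then have "\<one> \<otimes> k \<in> S" unfolding S_def using one_in_N by blast
  then show "k \<in> S" using k K_carrier by auto
qed

lemma one_in_S: "\<one> \<in> S"
  using K_subset_S one_in_K by blast

lemma N_mult_S:
  assumes "n \<in> N" "s \<in> S" shows "n \<otimes> s \<in> S"
proof -
  obtain m k where mk: "m \<in> N" "k \<in> K" "s = m \<otimes> k" using assms by (auto simp: S_def)
  have "n \<otimes> m \<in> N" using subgroup.m_closed[OF subgroup_N] assms mk by blast
  then have "(\<lambda>(n, k). n \<otimes> k) (n \<otimes> m, k) \<in> S" unfolding S_def using mk by (intro imageI) simp
  moreover have "n \<otimes> s = (n \<otimes> m) \<otimes> k" using mk assms N_carrier K_carrier by (auto simp: m_assoc)
  ultimately show ?thesis by simp
qed

lemma N_mult_S_iff: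
  assumes "n \<in> N" "s \<in> carrier G" shows "n \<otimes> s \<in> S \<longleftrightarrow> s \<in> S"
proof
  assume ns: "n \<otimes> s \<in> S"
  have "inv n \<in> N" using subgroup.m_inv_closed[OF subgroup_N] assms(1) .
  then have "inv n \<otimes> (n \<otimes> s) \<in> S" using ns by (rule N_mult_S)
  then show "s \<in> S" using assms(2) N_carrier[OF assms(1)] by simp
qed (use assms N_mult_S in blast)

text \<open>\<open>D D^-1 D D^-1\<close>: one factor \<open>D D^-1\<close> compares two overlapping
  copies of \<open>D\<close>, the second serves a chain of two overlaps in \<open>occ_mono\<close>.
  The four factors cause the fourth power in the counting.\<close>

definition offsets :: "'g set \<Rightarrow> 'g set" where
  "offsets D = (\<lambda>(a, b, c, d). a \<otimes> inv b \<otimes> (c \<otimes> inv d)) ` (D \<times> D \<times> D \<times> D)"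

lemma offsetsI: "a \<in> D \<Longrightarrow> b \<in> D \<Longrightarrow> c \<in> D \<Longrightarrow> d \<in> D \<Longrightarrow> a \<otimes> inv b \<otimes> (c \<otimes> inv d) \<in> offsets D"
  unfolding offsets_def by force

lemma offsetsI2: "D \<subseteq> carrier G \<Longrightarrow> a \<in> D \<Longrightarrow> b \<in> D \<Longrightarrow> a \<otimes> inv b \<in> offsets D"
  using offsetsI[of a D b a a] by (auto simp: subset_iff)

lemma offsets_carrier: "D \<subseteq> carrier G \<Longrightarrow> offsets D \<subseteq> carrier G"
  by (force simp: offsets_def)

lemma finite_offsets: "finite D \<Longrightarrow> finite (offsets D)"
  by (simp add: offsets_def)

lemma card_offsets: "finite D \<Longrightarrow> card (offsets D) \<le> card D ^ 4"
proof -
  assume "finite D"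
  then have "card (offsets D) \<le> card (D \<times> D \<times> D \<times> D)"
    unfolding offsets_def by (intro card_image_le) simp
  also have "\<dots> = card D ^ 4" by (simp add: card_cartesian_product power4_eq_xxxx)
  finally show ?thesis .
qed

definition fill :: "'g set \<Rightarrow> ('g \<Rightarrow> 'a) \<Rightarrow> ('g \<Rightarrow> 'a) set" where
  "fill B z = {restrict y S | y. y \<in> X \<and> (\<forall>d\<in>B. y d = z d)}"

text \<open>An extension can only lose fillings (\<open>fill_antimono\<close>), so the inclusion
  expresses equality of the two sets of fillings.\<close>

definition minimal :: "'g set \<Rightarrow> ('g \<Rightarrow> 'a) \<Rightarrow> bool" where
  "minimal B z \<longleftrightarrow> (\<forall>B' z'. finite B' \<and> B \<subseteq> B' \<and> B' \<subseteq> carrier G - S \<and> z' \<in> X \<and> (\<forall>d\<in>B. z' d = z d)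
     \<longrightarrow> fill B z \<subseteq> fill B' z')"

text \<open>For a finite window \<open>W\<close>, minimality applied to
  \<open>B \<union> (W - S)\<close> yields a point with the new filling on \<open>S\<close> and the
  values of \<open>y\<close> on the rest of \<open>W\<close>; closedness does the rest.\<close>

lemma refill_one:
  assumes B: "finite B" "B \<subseteq> carrier G - S" "minimal B z"
    and y: "y \<in> X" "\<And>d. d \<in> B \<Longrightarrow> y d = z d"
    and y': "y' \<in> carrier G \<rightarrow>\<^sub>E A" "\<And>t. t \<in> carrier G \<Longrightarrow> t \<notin> S \<Longrightarrow> y' t = y t" "restrict y' S \<in> fill B z"
  shows "y' \<in> X"
proof (rule in_X_if_locally_in_X[OF y'(1)])
  fix W assume W: "finite W" "W \<subseteq> carrier G"
  have "fill B z \<subseteq> fill (B \<union> (W - S)) y"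
    by (rule B(3)[unfolded minimal_def, rule_format]) (use B(1,2) y W in auto)
  then have "restrict y' S \<in> fill (B \<union> (W - S)) y" using y'(3) by (rule subsetD)
  then obtain u where u: "u \<in> X" "\<forall>d\<in>B \<union> (W - S). u d = y d" "restrict y' S = restrict u S"
    unfolding fill_def by auto
  have "u t = y' t" if "t \<in> W" for t
  proof (cases "t \<in> S")
    case True
    then show ?thesis using u(3) by (metis restrict_apply')
  next
    case False
    then show ?thesis using u(2) that W y'(2)[of t] y(2)[of t] by auto
  qed
  then show "\<exists>y\<in>X. \<forall>t\<in>W. y t = y' t" using u(1) by blast
qed

lemma refill:
  assumes B: "finite B" "B \<subseteq> carrier G - S" "minimal B z"
    and g: "g \<in> carrier G" and y: "y \<in> X" "\<And>d. d \<in> B \<Longrightarrow> y (g \<otimes> d) = z d"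
    and y': "y' \<in> carrier G \<rightarrow>\<^sub>E A" "\<And>t. t \<in> carrier G \<Longrightarrow> inv g \<otimes> t \<notin> S \<Longrightarrow> y' t = y t"
      "(\<lambda>s\<in>S. y' (g \<otimes> s)) \<in> fill B z"
  shows "y' \<in> X"
proof -
  have "lshift G (inv g) y' \<in> X"
  proof (rule refill_one[OF B])
    show "lshift G (inv g) y \<in> X" using g y(1) by (simp add: lshift_in_X)
    show "lshift G (inv g) y d = z d" if "d \<in> B" for d
      using that B(2) y(2) g by (auto simp: lshift_inv_apply)
    show "lshift G (inv g) y' \<in> carrier G \<rightarrow>\<^sub>E A"
      using y'(1) g by (auto simp: lshift_def PiE_iff)
    show "lshift G (inv g) y' t = lshift G (inv g) y t" if "t \<in> carrier G" "t \<notin> S" for t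
      using y'(2)[of "g \<otimes> t"] that g by (simp add: lshift_inv_apply)
    have "restrict (lshift G (inv g) y') S = (\<lambda>s\<in>S. y' (g \<otimes> s))"
      using g S_carrier by (auto simp: lshift_inv_apply intro!: restrict_ext)
    then show "restrict (lshift G (inv g) y') S \<in> fill B z" using y'(3) by simp
  qed
  then have "lshift G g (lshift G (inv g) y') \<in> X" using g lshift_in_X by blast
  moreover have "lshift G g (lshift G (inv g) y') = y'"
    using g y'(1) by (auto simp: lshift_def PiE_iff extensional_def)
  ultimately show ?thesis by simp
qed

end

section \<open>Marker automorphisms\<close>

text \<open>In \<open>isolated\<close> the disagreement is required at a cell outside
  \<open>S\<close>, because the cells of \<open>S\<close> are the ones that will be
  rewritten.\<close>

locale marker = si_shift G A X K
  for G :: "('g, 'm) monoid_scheme" (structure) and A :: "'a set" and X :: "('g \<Rightarrow> 'a) set"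
    and K :: "'g set" +
  fixes B :: "'g set" and z q :: "'g \<Rightarrow> 'a"
  assumes finite_B: "finite B" and B_sub: "B \<subseteq> carrier G - S" and z_in_X: "z \<in> X"
    and minimal_B: "minimal B z"
    and isolated: "\<And>e. e \<in> offsets (S \<union> B) \<Longrightarrow> e \<notin> N \<Longrightarrow> \<exists>d\<in>B. e \<otimes> d \<notin> S \<and> z (e \<otimes> d) \<noteq> z d"
    and q_fill: "q \<in> fill B z" and q_neq: "q \<noteq> restrict z S"
begin

lemma B_carrier: "d \<in> B \<Longrightarrow> d \<in> carrier G"
  and B_not_S: "d \<in> B \<Longrightarrow> d \<notin> S"
  using B_sub by auto

abbreviation E :: "'g set" where "E \<equiv> offsets (S \<union> B)"

lemma D_carrier: "S \<union> B \<subseteq> carrier G"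
  using S_carrier B_carrier by auto

lemma E_carrier: "e \<in> E \<Longrightarrow> e \<in> carrier G"
  using offsets_carrier[OF D_carrier] by auto

lemma E_I2: "a \<in> S \<union> B \<Longrightarrow> b \<in> S \<union> B \<Longrightarrow> a \<otimes> inv b \<in> E"
  by (rule offsetsI2[OF D_carrier])

text \<open>The second condition ignores the values on \<open>g S\<close>, so it survives refilling at \<open>g\<close>.\<close>
definition occ :: "('g \<Rightarrow> 'a) \<Rightarrow> 'g set" where
  "occ x = {g \<in> carrier G. (\<forall>d\<in>B. x (g \<otimes> d) = z d) \<and>
     (\<forall>e\<in>E - N. \<exists>d\<in>B. e \<otimes> d \<notin> S \<and> x (g \<otimes> (e \<otimes> d)) \<noteq> z d)}"

definition pat :: "('g \<Rightarrow> 'a) \<Rightarrow> 'g \<Rightarrow> 'g \<Rightarrow> 'a" where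
  "pat x g = (\<lambda>s\<in>S. x (g \<otimes> s))"

definition swap :: "('g \<Rightarrow> 'a) \<Rightarrow> 'g \<Rightarrow> 'a" where
  "swap u = (if u = restrict z S then q else if u = q then restrict z S else u)"

text \<open>The occurrence covering \<open>t\<close> is unique only modulo \<open>N\<close>, hence
  the choice; \<open>mark_eq_swap\<close> shows that the result does not depend on it.\<close>

definition mark :: "('g \<Rightarrow> 'a) \<Rightarrow> 'g \<Rightarrow> 'a" where
  "mark x = (\<lambda>t\<in>carrier G. if \<exists>g\<in>occ x. inv g \<otimes> t \<in> S
     then (let g = SOME g. g \<in> occ x \<and> inv g \<otimes> t \<in> S in swap (pat x g) (inv g \<otimes> t)) else x t)"

lemma swap_swap: "swap (swap u) = u"
  using q_neq by (auto simp: swap_def)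

lemma occ_carrier: "g \<in> occ x \<Longrightarrow> g \<in> carrier G"
  by (simp add: occ_def)

lemma occ_match: "g \<in> occ x \<Longrightarrow> d \<in> B \<Longrightarrow> x (g \<otimes> d) = z d"
  by (simp add: occ_def)

lemma occ_isolated:
  assumes "g \<in> occ x" "e \<in> E" "e \<notin> N"
  obtains d where "d \<in> B" "e \<otimes> d \<notin> S" "x (g \<otimes> (e \<otimes> d)) \<noteq> z d"
  using assms unfolding occ_def by blast

text \<open>For \<open>e = inv g \<otimes> h\<close> outside \<open>N\<close>, isolation at
  \<open>g\<close> would provide some \<open>d \<in> B\<close> with
  \<open>x (h \<otimes> d) \<noteq> z d\<close>.\<close>

lemma match_near_occ:
  assumes g: "g \<in> occ x" and h: "h \<in> carrier G" "\<And>d. d \<in> B \<Longrightarrow> x (h \<otimes> d) = z d"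
    and E: "inv g \<otimes> h \<in> E"
  shows "inv g \<otimes> h \<in> N"
proof (rule ccontr)
  assume "inv g \<otimes> h \<notin> N"
  then obtain d where d: "d \<in> B" "x (g \<otimes> (inv g \<otimes> h \<otimes> d)) \<noteq> z d"
    using occ_isolated[OF g E] by metis
  then show False using h occ_carrier[OF g] B_carrier by (simp add: m_assoc)
qed

lemma inv_mult_eq_quotient:
  assumes "g \<in> carrier G" "h \<in> carrier G" "t \<in> carrier G"
  shows "inv g \<otimes> h = (inv g \<otimes> t) \<otimes> inv (inv h \<otimes> t)"
  using assms by (simp add: gsimps)

lemma occ_overlap:
  assumes g: "g \<in> occ x" and h: "h \<in> occ x" and t: "t \<in> carrier G"
    and gt: "inv g \<otimes> t \<in> S \<union> B" and ht: "inv h \<otimes> t \<in> S \<union> B"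
  shows "inv g \<otimes> h \<in> N"
proof (rule match_near_occ[OF g])
  show "inv g \<otimes> h \<in> E"
    using E_I2[OF gt ht] inv_mult_eq_quotient g h t occ_carrier by metis
qed (use h occ_carrier occ_match in auto)

lemma occ_coset_S:
  assumes g: "g \<in> carrier G" and h: "h \<in> carrier G" and t: "t \<in> carrier G" and N: "inv g \<otimes> h \<in> N"
  shows "inv g \<otimes> t \<in> S \<longleftrightarrow> inv h \<otimes> t \<in> S"
proof -
  have "inv g \<otimes> t = (inv g \<otimes> h) \<otimes> (inv h \<otimes> t)" using g h t by (simp add: gsimps)
  then show ?thesis using N_mult_S_iff[OF N, of "inv h \<otimes> t"] h t by simp
qed

lemma pat_coset:
  assumes "x \<in> X" "g \<in> carrier G" "n \<in> N"
  shows "pat x (g \<otimes> n) = pat x g"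
  unfolding pat_def using assms S_carrier by (intro restrict_ext) (simp add: N_apply_right)

lemma fill_N:
  assumes "r \<in> fill B z" "n \<in> N" "s \<in> S"
  shows "r (n \<otimes> s) = r s"
proof -
  obtain y where "y \<in> X" "r = restrict y S" using assms(1) unfolding fill_def by blast
  then show ?thesis using assms N_mult_S N_apply S_carrier by simp
qed

lemma pat_fill:
  assumes x: "x \<in> X" and g: "g \<in> occ x"
  shows "pat x g \<in> fill B z"
proof -
  have gc: "g \<in> carrier G" using g by (rule occ_carrier)
  have "pat x g = restrict (lshift G (inv g) x) S"
    unfolding pat_def using gc S_carrier by (intro restrict_ext) (simp add: lshift_inv_apply)
  moreover have "lshift G (inv g) x \<in> X" using x gc by (simp add: lshift_in_X)
  moreover have "\<forall>d\<in>B. lshift G (inv g) x d = z d"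
    using occ_match[OF g] gc B_carrier by (simp add: lshift_inv_apply)
  ultimately show ?thesis unfolding fill_def by blast
qed

lemma swap_fill: "u \<in> fill B z \<Longrightarrow> swap u \<in> fill B z"
proof -
  have "restrict z S \<in> fill B z" using z_in_X unfolding fill_def by blast
  then show "swap u \<in> fill B z" if "u \<in> fill B z" using q_fill that by (simp add: swap_def)
qed

text \<open>Two occurrences covering \<open>t\<close> differ by an element of \<open>N\<close>. They
  read the same filling, and every filling, being cut from a point of \<open>X\<close>, is invariant
  under \<open>N\<close>.\<close>

lemma mark_eq_swap:
  assumes x: "x \<in> X" and g: "g \<in> occ x" and t: "t \<in> carrier G" "inv g \<otimes> t \<in> S"
  shows "mark x t = swap (pat x g) (inv g \<otimes> t)"
proof -
  define h where "h = (SOME g. g \<in> occ x \<and> inv g \<otimes> t \<in> S)"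
  have h: "h \<in> occ x" "inv h \<otimes> t \<in> S"
    using someI[of "\<lambda>g. g \<in> occ x \<and> inv g \<otimes> t \<in> S" g] g t unfolding h_def by auto
  note gc = occ_carrier[OF g] and hc = occ_carrier[OF h(1)]
  have n: "inv h \<otimes> g \<in> N" by (rule occ_overlap[OF h(1) g t(1)]) (use h(2) t(2) in auto)
  have "pat x (h \<otimes> (inv h \<otimes> g)) = pat x h" by (rule pat_coset[OF x hc n])
  then have "pat x g = pat x h" using gc hc by simp
  moreover have "inv h \<otimes> t = (inv h \<otimes> g) \<otimes> (inv g \<otimes> t)" using gc hc t by (simp add: gsimps)
  ultimately have "swap (pat x h) (inv h \<otimes> t) = swap (pat x g) (inv g \<otimes> t)"
    using fill_N[OF swap_fill[OF pat_fill[OF x g]] n t(2)] by simp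
  moreover have "mark x t = swap (pat x h) (inv h \<otimes> t)"
    unfolding mark_def h_def using g t by (auto simp: Let_def)
  ultimately show ?thesis by simp
qed

lemma mark_eq_other:
  assumes "t \<in> carrier G" "\<And>g. g \<in> occ x \<Longrightarrow> inv g \<otimes> t \<notin> S"
  shows "mark x t = x t"
  using assms by (auto simp: mark_def)

text \<open>The cells \<open>h B\<close> avoid all supports \<open>g S\<close>, so the match at
  \<open>h\<close> survives. An isolation witness inside some support may be spoiled; it is then
  replaced by a witness outside all supports.\<close>

lemma occ_mono:
  assumes eq: "\<And>t. t \<in> carrier G \<Longrightarrow> (\<And>g. g \<in> occ x \<Longrightarrow> inv g \<otimes> t \<notin> S) \<Longrightarrow> y t = x t"
  shows "occ x \<subseteq> occ y"
proof
  fix h assume h: "h \<in> occ x"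
  note hc = occ_carrier[OF h]
  have "y (h \<otimes> d) = z d" if d: "d \<in> B" for d
  proof -
    have "inv g \<otimes> (h \<otimes> d) \<notin> S" if g: "g \<in> occ x" for g
    proof
      note gc = occ_carrier[OF g]
      assume S: "inv g \<otimes> (h \<otimes> d) \<in> S"
      have "inv g \<otimes> h \<in> N"
        by (rule occ_overlap[OF g h, of "h \<otimes> d"]) (use S d hc B_carrier in auto)
      then have "inv h \<otimes> (h \<otimes> d) \<in> S"
        using S occ_coset_S[OF gc hc, of "h \<otimes> d"] hc d B_carrier by simp
      then show False using hc d B_carrier B_not_S by simp
    qed
    then have "y (h \<otimes> d) = x (h \<otimes> d)" using hc d B_carrier by (intro eq) auto
    then show ?thesis using occ_match[OF h d] by simp
  qed
  moreover have "\<exists>d\<in>B. e \<otimes> d \<notin> S \<and> y (h \<otimes> (e \<otimes> d)) \<noteq> z d" if e: "e \<in> E" "e \<notin> N" for e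
  proof -
    have ec: "e \<in> carrier G" using e by (rule_tac E_carrier)
    obtain d where d: "d \<in> B" "e \<otimes> d \<notin> S" "x (h \<otimes> (e \<otimes> d)) \<noteq> z d"
      using occ_isolated[OF h e] by blast
    have dc: "d \<in> carrier G" using d by (simp add: B_carrier)
    show ?thesis
    proof (cases "\<exists>g\<in>occ x. inv g \<otimes> (h \<otimes> (e \<otimes> d)) \<in> S")
      case False
      then have "y (h \<otimes> (e \<otimes> d)) = x (h \<otimes> (e \<otimes> d))" using hc ec dc by (intro eq) auto
      then show ?thesis using d by auto
    next
      case True
      then obtain g where g: "g \<in> occ x" and S: "inv g \<otimes> (h \<otimes> (e \<otimes> d)) \<in> S" by blast
      note gc = occ_carrier[OF g]
      \<comment> \<open>The old witness lies in the support of \<open>g\<close>. Seen from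
        \<open>g\<close>, the translate of the pattern by \<open>e\<close> from \<open>h\<close>
        sits at displacement \<open>c\<close>; isolation of \<open>g\<close> against
        \<open>c\<close> yields an index \<open>d'\<close> whose cell also serves
        \<open>h\<close>.\<close>
      define c where "c = inv g \<otimes> (h \<otimes> e)"
      have cc: "c \<in> carrier G" using gc hc ec by (simp add: c_def)
      have cd: "c \<otimes> d \<in> S" using S gc hc ec dc by (simp add: c_def m_assoc)
      have gh: "inv g \<otimes> h \<notin> N"
      proof
        assume "inv g \<otimes> h \<in> N"
        then have "inv h \<otimes> (h \<otimes> (e \<otimes> d)) \<in> S"
          using S occ_coset_S[OF gc hc, of "h \<otimes> (e \<otimes> d)"] hc ec dc by simp
        then show False using hc ec dc d by simp
      qed
      have "c \<in> E"
        using E_I2[of "c \<otimes> d" d] cd d cc dc by (simp add: m_assoc)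
      moreover have "c \<notin> N"
        using N_mult_S_iff[of c d] cd dc B_not_S[OF d(1)] by blast
      ultimately obtain d' where d': "d' \<in> B" "c \<otimes> d' \<notin> S" "x (g \<otimes> (c \<otimes> d')) \<noteq> z d'"
        using occ_isolated[OF g] by metis
      have dc': "d' \<in> carrier G" using d' by (simp add: B_carrier)
      have pos: "g \<otimes> (c \<otimes> d') = h \<otimes> (e \<otimes> d')"
        using gc hc ec dc' by (simp add: c_def m_assoc)
      \<comment> \<open>Going from \<open>g\<close> to \<open>k\<close> through the old and the new
        witness cell gives a product of four factors, which is what \<open>offsets\<close> provides
        for.\<close>
      have far: "k \<in> occ x \<Longrightarrow> inv k \<otimes> (h \<otimes> (e \<otimes> d')) \<in> S \<Longrightarrow> inv g \<otimes> k \<in> N" for k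
      proof -
        assume k: "k \<in> occ x" and kS: "inv k \<otimes> (h \<otimes> (e \<otimes> d')) \<in> S"
        note kc = occ_carrier[OF k]
        have "(c \<otimes> d) \<otimes> inv d \<otimes> (d' \<otimes> inv (inv k \<otimes> (h \<otimes> (e \<otimes> d')))) \<in> E"
          using cd d d' kS by (intro offsetsI) auto
        moreover have "(c \<otimes> d) \<otimes> inv d \<otimes> (d' \<otimes> inv (inv k \<otimes> (h \<otimes> (e \<otimes> d')))) = inv g \<otimes> k"
          using gc hc ec dc dc' kc by (simp add: c_def gsimps)
        ultimately have "inv g \<otimes> k \<in> E" by simp
        then show "inv g \<otimes> k \<in> N"
          using match_near_occ[OF g kc] occ_match[OF k] by simp
      qed
      have notS: "inv k \<otimes> (h \<otimes> (e \<otimes> d')) \<notin> S" if k: "k \<in> occ x" for k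
      proof
        assume kS: "inv k \<otimes> (h \<otimes> (e \<otimes> d')) \<in> S"
        have "inv g \<otimes> (h \<otimes> (e \<otimes> d')) \<in> S"
          using occ_coset_S[OF gc occ_carrier[OF k] _ far[OF k kS], of "h \<otimes> (e \<otimes> d')"] kS hc ec dc'
          by simp
        then show False using d'(2) gc hc ec dc' by (simp add: c_def m_assoc)
      qed
      \<comment> \<open>\<open>h\<close> is itself an occurrence, so \<open>notS\<close> applies to
        it.\<close>
      have "e \<otimes> d' \<notin> S"
        using notS[OF h] hc ec dc' by simp
      moreover have "y (h \<otimes> (e \<otimes> d')) = x (h \<otimes> (e \<otimes> d'))"
        using notS hc ec dc' by (intro eq) auto
      ultimately show ?thesis using d' pos by auto
    qed
  qed
  ultimately show "h \<in> occ y" using hc by (simp add: occ_def)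
qed

text \<open>The first inclusion shows that the cells changed by \<open>mark\<close> are also covered
  by occurrences in \<open>mark x\<close>, so \<open>occ_mono\<close> applies in the other direction
  too.\<close>

lemma occ_mark:
  shows "occ (mark x) = occ x"
proof
  show sub: "occ x \<subseteq> occ (mark x)" by (rule occ_mono) (simp add: mark_eq_other)
  show "occ (mark x) \<subseteq> occ x"
  proof (rule occ_mono)
    fix t assume "t \<in> carrier G" "\<And>g. g \<in> occ (mark x) \<Longrightarrow> inv g \<otimes> t \<notin> S"
    then show "x t = mark x t" using sub by (subst mark_eq_other) auto
  qed
qed

lemma pat_mark:
  assumes x: "x \<in> X" and g: "g \<in> occ x"
  shows "pat (mark x) g = swap (pat x g)"
proof
  fix s
  have ext: "swap (pat x g) \<in> extensional S"
    using swap_fill[OF pat_fill[OF x g]] unfolding fill_def by auto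
  show "pat (mark x) g s = swap (pat x g) s"
  proof (cases "s \<in> S")
    case True
    then have "mark x (g \<otimes> s) = swap (pat x g) (inv g \<otimes> (g \<otimes> s))"
      using occ_carrier[OF g] S_carrier by (intro mark_eq_swap[OF x g]) auto
    then show ?thesis using True occ_carrier[OF g] S_carrier by (simp add: pat_def)
  next
    case False
    then show ?thesis using ext by (simp add: pat_def extensional_def)
  qed
qed

lemma mark_PiE:
  assumes x: "x \<in> X"
  shows "mark x \<in> carrier G \<rightarrow>\<^sub>E A"
proof -
  have "mark x t \<in> A" if t: "t \<in> carrier G" for t
  proof (cases "\<exists>g\<in>occ x. inv g \<otimes> t \<in> S")
    case True
    then obtain g where g: "g \<in> occ x" "inv g \<otimes> t \<in> S" by blast
    obtain y where y: "y \<in> X" "swap (pat x g) = restrict y S"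
      using swap_fill[OF pat_fill[OF x g(1)]] unfolding fill_def by blast
    then have "mark x t = y (inv g \<otimes> t)" using mark_eq_swap[OF x g(1) t g(2)] g(2) by simp
    then show ?thesis using X_subset y(1) S_carrier[OF g(2)] by (auto simp: PiE_iff)
  next
    case False
    then have "mark x t = x t" using t by (intro mark_eq_other) auto
    then show ?thesis using X_subset x t by (auto simp: PiE_iff)
  qed
  then show ?thesis by (simp add: mark_def PiE_iff)
qed

text \<open>Finitely many exchanges are legal one after another by \<open>refill\<close>. A finite
  window meets only finitely many supports, so closedness of \<open>X\<close> handles all exchanges
  together.\<close>

lemma mark_in_X:
  assumes x: "x \<in> X"
  shows "mark x \<in> X"
proof (rule in_X_if_locally_in_X[OF mark_PiE[OF x]])
  define part where
    "part J = (\<lambda>t\<in>carrier G. if \<exists>g\<in>J. inv g \<otimes> t \<in> S then mark x t else x t)" for J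
  have part_in_X: "part J \<in> X" if "finite J" "J \<subseteq> occ x" for J
    using that
  proof (induction J rule: finite_induct)
    case empty
    have "x \<in> extensional (carrier G)" using X_subset x by (auto simp: PiE_iff)
    then have "part {} = x" by (auto simp: part_def extensional_def)
    then show ?case using x by simp
  next
    case (insert g J)
    then have g: "g \<in> occ x" and J: "part J \<in> X" by auto
    note gc = occ_carrier[OF g]
    have part_eq: "part J' t = x t \<or> part J' t = mark x t" if "t \<in> carrier G" for J' t
      using that by (simp add: part_def)
    show ?case
    proof (rule refill[OF finite_B B_sub minimal_B gc J])
      fix d assume d: "d \<in> B"
      \<comment> \<open>\<open>part J\<close> takes each value from \<open>x\<close> or from
        \<open>mark x\<close>, and both match \<open>z\<close> on the cells
        \<open>g \<otimes> d\<close>.\<close>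
      have "g \<in> occ (mark x)" using g by (simp add: occ_mark)
      then show "part J (g \<otimes> d) = z d"
        using part_eq[of "g \<otimes> d" J] gc d B_carrier occ_match[OF g d] occ_match[of g "mark x" d] by auto
    next
      have "part (insert g J) t \<in> A" if "t \<in> carrier G" for t
        using part_eq[OF that, of "insert g J"] X_subset x mark_PiE[OF x] that by (auto simp: PiE_iff)
      then show "part (insert g J) \<in> carrier G \<rightarrow>\<^sub>E A" by (simp add: part_def PiE_iff)
    next
      fix t assume "t \<in> carrier G" "inv g \<otimes> t \<notin> S"
      then show "part (insert g J) t = part J t" by (simp add: part_def)
    next
      have "(\<lambda>s\<in>S. part (insert g J) (g \<otimes> s)) = pat (mark x) g"
        unfolding pat_def part_def using gc S_carrier by (intro restrict_ext) simp
      then show "(\<lambda>s\<in>S. part (insert g J) (g \<otimes> s)) \<in> fill B z"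
        using pat_mark[OF x g] swap_fill[OF pat_fill[OF x g]] by simp
    qed
  qed
  fix W assume W: "finite W" "W \<subseteq> carrier G"
  define J where "J = {g \<in> occ x. \<exists>t\<in>W. inv g \<otimes> t \<in> S}"
  have "J \<subseteq> (\<lambda>(t, s). t \<otimes> inv s) ` (W \<times> S)"
  proof
    fix g assume "g \<in> J"
    then obtain t where t: "g \<in> occ x" "t \<in> W" "inv g \<otimes> t \<in> S" by (auto simp: J_def)
    then have "g = (\<lambda>(t, s). t \<otimes> inv s) (t, inv g \<otimes> t)"
      using W occ_carrier[OF t(1)] by (auto simp: gsimps)
    then show "g \<in> (\<lambda>(t, s). t \<otimes> inv s) ` (W \<times> S)" using t by (intro image_eqI) auto
  qed
  then have "finite J" using finite_S W by (meson finite_SigmaI finite_imageI finite_subset)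
  then have "part J \<in> X" by (rule part_in_X) (auto simp: J_def)
  moreover have "part J t = mark x t" if t: "t \<in> W" for t
  proof (cases "\<exists>g\<in>occ x. inv g \<otimes> t \<in> S")
    case True
    then show ?thesis using t W by (auto simp: part_def J_def)
  next
    case False
    then have "mark x t = x t" using t W by (intro mark_eq_other) auto
    then show ?thesis using t W by (auto simp: part_def)
  qed
  ultimately show "\<exists>y\<in>X. \<forall>t\<in>W. y t = mark x t" by blast
qed

lemma mark_mark:
  assumes x: "x \<in> X"
  shows "mark (mark x) = x"
proof (rule X_eqI)
  fix t assume t: "t \<in> carrier G"
  show "mark (mark x) t = x t"
  proof (cases "\<exists>g\<in>occ x. inv g \<otimes> t \<in> S")
    case True
    then obtain g where g: "g \<in> occ x" "inv g \<otimes> t \<in> S" by blast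
    have "mark (mark x) t = swap (pat (mark x) g) (inv g \<otimes> t)"
      by (rule mark_eq_swap[OF mark_in_X[OF x] _ t g(2)]) (simp add: g occ_mark)
    also have "\<dots> = pat x g (inv g \<otimes> t)" by (simp add: pat_mark[OF x g(1)] swap_swap)
    finally show ?thesis using g t occ_carrier by (simp add: pat_def)
  next
    case False
    then have "mark (mark x) t = mark x t" using t by (intro mark_eq_other) (auto simp: occ_mark)
    also have "\<dots> = x t" using False t by (intro mark_eq_other) auto
    finally show ?thesis .
  qed
qed (use x mark_in_X in auto)

lemma occ_lshift:
  assumes k: "k \<in> carrier G" and g: "g \<in> carrier G"
  shows "g \<in> occ (lshift G k x) \<longleftrightarrow> inv k \<otimes> g \<in> occ x"
proof -
  have "lshift G k x (g \<otimes> d) = x (inv k \<otimes> g \<otimes> d)" if "d \<in> carrier G" for d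
    using k g that by (simp add: lshift_apply m_assoc)
  then show ?thesis using k g B_carrier E_carrier by (simp add: occ_def)
qed

lemma mark_lshift:
  assumes k: "k \<in> carrier G" and x: "x \<in> X"
  shows "mark (lshift G k x) = lshift G k (mark x)"
proof (rule X_eqI)
  note kx = lshift_in_X[OF k x]
  fix t assume t: "t \<in> carrier G"
  then have kt: "inv k \<otimes> t \<in> carrier G" using k by simp
  show "mark (lshift G k x) t = lshift G k (mark x) t"
  proof (cases "\<exists>g\<in>occ x. inv g \<otimes> (inv k \<otimes> t) \<in> S")
    case True
    then obtain g where g: "g \<in> occ x" "inv g \<otimes> (inv k \<otimes> t) \<in> S" by blast
    note gc = occ_carrier[OF g(1)]
    have eq: "inv (k \<otimes> g) \<otimes> t = inv g \<otimes> (inv k \<otimes> t)" using k gc t by (simp add: gsimps)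
    have kg: "k \<otimes> g \<in> occ (lshift G k x)" using k gc g by (simp add: occ_lshift)
    have "pat (lshift G k x) (k \<otimes> g) = pat x g"
      unfolding pat_def using k gc S_carrier
      by (intro restrict_ext) (simp add: lshift_apply gsimps)
    then have "mark (lshift G k x) t = swap (pat x g) (inv g \<otimes> (inv k \<otimes> t))"
      using mark_eq_swap[OF kx kg t] eq g by simp
    also have "\<dots> = mark x (inv k \<otimes> t)" using mark_eq_swap[OF x g(1) kt g(2)] by simp
    finally show ?thesis using k t by (simp add: lshift_apply)
  next
    case False
    have "mark (lshift G k x) t = lshift G k x t"
    proof (rule mark_eq_other[OF t])
      fix g assume g: "g \<in> occ (lshift G k x)"
      note gc = occ_carrier[OF g]
      have "inv k \<otimes> g \<in> occ x" using g occ_lshift[OF k gc] by simp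
      then have "inv (inv k \<otimes> g) \<otimes> (inv k \<otimes> t) \<notin> S" using False by blast
      then show "inv g \<otimes> t \<notin> S" using k gc t by (simp add: gsimps)
    qed
    also have "\<dots> = mark x (inv k \<otimes> t)"
      using k t False kt mark_eq_other[OF kt, of x] by (auto simp: lshift_apply)
    finally show ?thesis using k t by (simp add: lshift_apply)
  qed
qed (use k x mark_in_X lshift_in_X in auto)

lemma mark_local:
  assumes x: "x \<in> X" and t: "t \<in> carrier G"
  shows "\<exists>W. finite W \<and> W \<subseteq> carrier G \<and> (\<forall>y\<in>X. (\<forall>s\<in>W. y s = x s) \<longrightarrow> mark y t = mark x t)"
proof (intro exI conjI ballI impI)
  \<comment> \<open>An occurrence covering \<open>t\<close> sits at some
    \<open>g \<in> t S^-1\<close>. The window contains all cells that decide whether such a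
    \<open>g\<close> is an occurrence and which filling it shows.\<close>
  define V where "V = {t} \<union> (\<lambda>(s, d). t \<otimes> inv s \<otimes> d) ` (S \<times> (S \<union> B))
    \<union> (\<lambda>(s, e, d). t \<otimes> inv s \<otimes> (e \<otimes> d)) ` (S \<times> E \<times> B)"
  show "finite V" using finite_S finite_B finite_offsets by (simp add: V_def)
  show "V \<subseteq> carrier G" using t S_carrier B_carrier E_carrier by (auto simp: V_def)
  fix y assume y: "y \<in> X" and eq: "\<forall>s\<in>V. y s = x s"
  have eqB: "y (g \<otimes> d) = x (g \<otimes> d)"
    if "g \<in> carrier G" "inv g \<otimes> t \<in> S" "d \<in> S \<union> B" for g d
  proof -
    have "(\<lambda>(s, d). t \<otimes> inv s \<otimes> d) (inv g \<otimes> t, d) \<in> V"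
      unfolding V_def using that by (intro UnI1 UnI2 imageI) auto
    then show ?thesis using eq that t by (auto simp: gsimps)
  qed
  have eqE: "y (g \<otimes> (e \<otimes> d)) = x (g \<otimes> (e \<otimes> d))"
    if "g \<in> carrier G" "inv g \<otimes> t \<in> S" "d \<in> B" "e \<in> E" for g d e
  proof -
    have "(\<lambda>(s, e, d). t \<otimes> inv s \<otimes> (e \<otimes> d)) (inv g \<otimes> t, e, d) \<in> V"
      unfolding V_def using that by (intro UnI2 imageI) auto
    then show ?thesis using eq that t E_carrier B_carrier by (auto simp: gsimps)
  qed
  have occ_eq: "g \<in> occ y \<longleftrightarrow> g \<in> occ x" if "g \<in> carrier G" "inv g \<otimes> t \<in> S" for g
    using that eqB eqE by (simp add: occ_def)
  show "mark y t = mark x t"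
  proof (cases "\<exists>g\<in>occ x. inv g \<otimes> t \<in> S")
    case True
    then obtain g where g: "g \<in> occ x" "inv g \<otimes> t \<in> S" by blast
    note gc = occ_carrier[OF g(1)]
    have "pat y g = pat x g"
      unfolding pat_def using eqB[OF gc g(2)] by (intro restrict_ext) simp
    then show ?thesis
      using mark_eq_swap[OF x g(1) t g(2)] mark_eq_swap[OF y _ t g(2)] occ_eq[OF gc g(2)] g by simp
  next
    case False
    then have "mark x t = x t" using t by (intro mark_eq_other) auto
    moreover have "mark y t = y t"
      using t False occ_eq occ_carrier by (intro mark_eq_other) auto
    ultimately show ?thesis using eq by (simp add: V_def)
  qed
qed

lemma one_in_occ: "\<one> \<in> occ z"
  using isolated B_carrier E_carrier by (simp add: occ_def)

text \<open>The occurrence at \<open>\<one>\<close> in \<open>z\<close> shows the filling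
  \<open>restrict z S\<close>, which is exchanged for \<open>q\<close>.\<close>

lemma mark_z_neq:
  obtains t where "t \<in> S" "mark z t \<noteq> z t"
proof -
  have p: "pat z \<one> = restrict z S"
    unfolding pat_def using S_carrier by (intro restrict_ext) simp
  have "pat (mark z) \<one> = q"
    using pat_mark[OF z_in_X one_in_occ] p by (simp add: swap_def)
  then have "pat (mark z) \<one> \<noteq> pat z \<one>" using q_neq p by simp
  then obtain s where s: "pat (mark z) \<one> s \<noteq> pat z \<one> s" by blast
  then have "s \<in> S" by (auto simp: pat_def split: if_splits)
  with s show thesis using that[of s] S_carrier by (simp add: pat_def)
qed

lemma mark_neqE:
  assumes "t \<in> carrier G" "mark y t \<noteq> y t"
  obtains g where "g \<in> occ y" "inv g \<otimes> t \<in> S"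
  using assms mark_eq_other by blast

lemma mark_Aut: "restrict mark X \<in> carrier (Aut_shift G A X)"
proof -
  have bij: "bij_betw (restrict mark X) X X"
    by (rule bij_betw_byWitness[where f' = "restrict mark X"]) (use mark_mark mark_in_X in auto)
  have "continuous_map TX TX (restrict mark X)"
  proof (rule continuous_mapI_local)
    fix x t assume "x \<in> X" "t \<in> carrier G"
    then show "\<exists>W. finite W \<and> W \<subseteq> carrier G \<and>
      (\<forall>y\<in>X. (\<forall>s\<in>W. y s = x s) \<longrightarrow> restrict mark X y t = restrict mark X x t)"
      using mark_local[of x t] by simp
  qed (use mark_in_X in auto)
  then have "homeomorphic_maps TX TX (restrict mark X) (restrict mark X)"
    unfolding homeomorphic_maps_def topspace_TX using mark_mark mark_in_X by auto
  then have "homeomorphic_map TX TX (restrict mark X)"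
    using homeomorphic_map_maps by blast
  then show ?thesis
    using bij mark_lshift lshift_in_X by (simp add: Aut_shift_def Bij_def)
qed

end

section \<open>Sparse sets and counting\<close>

text \<open>One \<open>k\<close> at a time: a finite image has an infinite fibre, an infinite image
  has a section. It is applied to the conjugations
  \<open>r \<otimes> k \<otimes> inv r\<close>.\<close>

lemma infinite_subset_const_or_inj:
  assumes "finite K" "infinite Y"
  shows "\<exists>Y'\<subseteq>Y. infinite Y' \<and> (\<forall>k\<in>K. inj_on (h k) Y' \<or> (\<forall>r\<in>Y'. \<forall>s\<in>Y'. h k r = h k s))"
  using assms
proof (induction K rule: finite_induct)
  case (insert k K)
  then obtain Y' where Y': "Y' \<subseteq> Y" "infinite Y'"
    and h: "\<And>k. k \<in> K \<Longrightarrow> inj_on (h k) Y' \<or> (\<forall>r\<in>Y'. \<forall>s\<in>Y'. h k r = h k s)" by blast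
  have "\<exists>Z\<subseteq>Y'. infinite Z \<and> (inj_on (h k) Z \<or> (\<forall>r\<in>Z. \<forall>s\<in>Z. h k r = h k s))"
  proof (cases "finite (h k ` Y')")
    case True
    then obtain r where "r \<in> Y'" "infinite {s \<in> Y'. h k s = h k r}"
      using pigeonhole_infinite[OF Y'(2)] by blast
    then show ?thesis by (intro exI[of _ "{s \<in> Y'. h k s = h k r}"]) auto
  next
    case False
    have "inj_on (h k) (inv_into Y' (h k) ` h k ` Y')"
      by (rule inj_onI) (auto simp: f_inv_into_f)
    moreover have "infinite (inv_into Y' (h k) ` h k ` Y')"
      using False finite_image_iff[OF inj_on_inv_into, of "h k ` Y'" "h k" Y'] by auto
    moreover have "inv_into Y' (h k) ` h k ` Y' \<subseteq> Y'" by (auto intro: inv_into_into)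
    ultimately show ?thesis by blast
  qed
  then obtain Z where Z: "Z \<subseteq> Y'" "infinite Z"
    "inj_on (h k) Z \<or> (\<forall>r\<in>Z. \<forall>s\<in>Z. h k r = h k s)" by blast
  have "inj_on (h k') Z \<or> (\<forall>r\<in>Z. \<forall>s\<in>Z. h k' r = h k' s)" if "k' \<in> K" for k'
    using h[OF that] Z(1) by (meson inj_on_subset subset_iff)
  then show ?case using Z Y'(1) by (intro exI[of _ Z]) auto
qed auto

text \<open>Union bound: a word agreeing with \<open>f e\<close> off \<open>bad e\<close> is
  determined by its letters on \<open>bad e\<close>, so each \<open>e\<close> excludes at most
  \<open>2 ^ c\<close> of the \<open>2 ^ m\<close> words.\<close>

lemma exists_word_avoiding:
  fixes f :: "'e \<Rightarrow> nat \<Rightarrow> 'a"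
  assumes fin: "finite Es" and bad: "\<And>e. e \<in> Es \<Longrightarrow> bad e \<subseteq> {..<m} \<and> card (bad e) \<le> c"
    and ab: "a \<noteq> b" and small: "card Es * 2 ^ c < (2::nat) ^ m"
  shows "\<exists>w. (\<forall>i<m. w i = a \<or> w i = b) \<and> (\<forall>e\<in>Es. \<exists>i<m. i \<notin> bad e \<and> w i \<noteq> f e i)"
proof -
  define W where "W = ({..<m} \<rightarrow>\<^sub>E {a, b})"
  define Bad where "Bad e = {w \<in> W. \<forall>i\<in>{..<m} - bad e. w i = f e i}" for e
  have finW: "finite W" unfolding W_def by (intro finite_PiE) auto
  have "card (Bad e) \<le> 2 ^ c" if e: "e \<in> Es" for e
  proof -
    have "card (Bad e) \<le> card (bad e \<rightarrow>\<^sub>E {a, b})"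
    proof (rule card_inj_on_le)
      show "inj_on (\<lambda>w. restrict w (bad e)) (Bad e)"
      proof (rule inj_onI)
        fix v w assume v: "v \<in> Bad e" and w: "w \<in> Bad e"
          and eq: "restrict v (bad e) = restrict w (bad e)"
        have "v i = w i" if "i < m" for i
        proof (cases "i \<in> bad e")
          case True then show ?thesis using eq by (metis restrict_apply')
        next
          case False then show ?thesis using v w that by (simp add: Bad_def)
        qed
        moreover have "v \<in> {..<m} \<rightarrow>\<^sub>E {a, b}" "w \<in> {..<m} \<rightarrow>\<^sub>E {a, b}"
          using v w by (auto simp: Bad_def W_def)
        ultimately show "v = w" by (metis PiE_ext lessThan_iff)
      qed
      show "(\<lambda>w. restrict w (bad e)) ` Bad e \<subseteq> bad e \<rightarrow>\<^sub>E {a, b}"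
        using bad[OF e] by (auto simp: Bad_def W_def PiE_iff)
      show "finite (bad e \<rightarrow>\<^sub>E {a, b})"
        using bad[OF e] finite_subset by (intro finite_PiE) auto
    qed
    also have "\<dots> = 2 ^ card (bad e)"
      using bad[OF e] ab finite_subset[of "bad e" "{..<m}"]
      by (subst card_PiE) (auto simp: numeral_2_eq_2)
    also have "\<dots> \<le> 2 ^ c" using bad[OF e] by (intro power_increasing) auto
    finally show ?thesis .
  qed
  then have "card (\<Union>e\<in>Es. Bad e) \<le> card Es * 2 ^ c"
    using card_UN_le[OF fin, of Bad] sum_bounded_above[of Es "\<lambda>e. card (Bad e)" "2 ^ c"] by simp
  also have "\<dots> < card W" using small ab by (simp add: W_def card_PiE numeral_2_eq_2)
  finally have "(\<Union>e\<in>Es. Bad e) \<noteq> W" by auto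
  moreover have "(\<Union>e\<in>Es. Bad e) \<subseteq> W" by (auto simp: Bad_def)
  ultimately obtain w where w: "w \<in> W" "w \<notin> (\<Union>e\<in>Es. Bad e)" by blast
  show ?thesis
  proof (intro exI[of _ w] conjI allI ballI impI)
    show "w i = a \<or> w i = b" if "i < m" for i using w(1) that by (auto simp: W_def PiE_iff)
    show "\<exists>i<m. i \<notin> bad e \<and> w i \<noteq> f e i" if "e \<in> Es" for e
      using w that by (auto simp: Bad_def)
  qed
qed

lemma exponential_beats_quartic: "\<exists>m::nat. (n + m) ^ 4 * c < (2::nat) ^ m"
proof -
  have "eventually (\<lambda>m. (real n + real m) ^ 4 * real c < 2 ^ m) sequentially" by real_asymp
  then obtain m where "(real n + real m) ^ 4 * real c < 2 ^ m"
    using eventually_happens'[OF sequentially_bot] by blast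
  then have "real ((n + m) ^ 4 * c) < real (2 ^ m)" by simp
  then show ?thesis by (simp only: of_nat_less_iff) blast
qed

section \<open>Minimal patterns and sparse sequences\<close>

context si_shift
begin

lemma finite_fill: "finite (fill B z)"
proof (rule finite_subset)
  show "fill B z \<subseteq> S \<rightarrow>\<^sub>E A"
    using X_subset S_carrier by (force simp: fill_def PiE_iff)
  show "finite (S \<rightarrow>\<^sub>E A)" using finite_S finite_alphabet by (intro finite_PiE) auto
qed

lemma fill_antimono: "B \<subseteq> B' \<Longrightarrow> (\<And>d. d \<in> B \<Longrightarrow> z' d = z d) \<Longrightarrow> fill B' z' \<subseteq> fill B z"
  unfolding fill_def by (intro Collect_mono impI; elim exE conjE) (metis subsetD)

text \<open>The chain \<open>fill B' z' \<subseteq> fill B z \<subseteq> fill C y\<close> suffices.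
  Isolating cells can thus be added to a minimal pattern afterwards.\<close>

lemma minimal_extend:
  assumes "minimal B z" "B \<subseteq> B'" "finite B'" "B' \<subseteq> carrier G - S" "z' \<in> X" "\<And>d. d \<in> B \<Longrightarrow> z' d = z d"
  shows "minimal B' z'"
  unfolding minimal_def
proof (intro allI impI)
  fix C y assume C: "finite C \<and> B' \<subseteq> C \<and> C \<subseteq> carrier G - S \<and> y \<in> X \<and> (\<forall>d\<in>B'. y d = z' d)"
  have "fill B' z' \<subseteq> fill B z" using assms by (intro fill_antimono) auto
  also have "fill B z \<subseteq> fill C y"
    by (rule assms(1)[unfolded minimal_def, rule_format]) (use C assms(2,6) in auto)
  finally show "fill B' z' \<subseteq> fill C y" .
qed

text \<open>Sets of fillings are finite, so some extension has the fewest; extending it further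
  cannot lose any.\<close>

lemma minimal_exists:
  assumes "finite B" "B \<subseteq> carrier G - S" "z \<in> X"
  obtains B' z' where "finite B'" "B \<subseteq> B'" "B' \<subseteq> carrier G - S" "z' \<in> X"
    "\<And>d. d \<in> B \<Longrightarrow> z' d = z d" "minimal B' z'"
proof -
  define Q where "Q = (\<lambda>(B', z'). finite B' \<and> B \<subseteq> B' \<and> B' \<subseteq> carrier G - S \<and> z' \<in> X \<and> (\<forall>d\<in>B. z' d = z d))"
  have "Q (B, z)" using assms by (simp add: Q_def)
  then obtain P where P: "Q P" "\<And>P'. Q P' \<Longrightarrow> card (case_prod fill P) \<le> card (case_prod fill P')"
    using ex_has_least_nat[of Q "(B, z)" "\<lambda>P. card (case_prod fill P)"] by blast
  obtain B' z' where Pe: "P = (B', z')" by (cases P)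
  have B': "finite B'" "B \<subseteq> B'" "B' \<subseteq> carrier G - S" "z' \<in> X" "\<And>d. d \<in> B \<Longrightarrow> z' d = z d"
    using P(1) unfolding Pe Q_def by auto
  moreover have "minimal B' z'"
    unfolding minimal_def
  proof (intro allI impI)
    fix C y assume C: "finite C \<and> B' \<subseteq> C \<and> C \<subseteq> carrier G - S \<and> y \<in> X \<and> (\<forall>d\<in>B'. y d = z' d)"
    then have "Q (C, y)" using B' by (auto simp: Q_def)
    then have "card (fill B' z') \<le> card (fill C y)" using P(2)[of "(C, y)"] Pe by simp
    moreover have "fill C y \<subseteq> fill B' z'" using C by (intro fill_antimono) auto
    ultimately show "fill B' z' \<subseteq> fill C y"
      using card_seteq[OF finite_fill] by metis
  qed
  ultimately show thesis by (rule that)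
qed

text \<open>\<open>B\<close> avoids \<open>S\<close> and hence \<open>K\<close>, so a different
  letter can be glued in at \<open>\<one>\<close> while \<open>B\<close> is kept.\<close>

lemma other_filling:
  assumes "finite B" "B \<subseteq> carrier G - S" "z \<in> X"
  obtains q where "q \<in> fill B z" "q \<noteq> restrict z S"
proof -
  obtain x where x: "x \<in> X" "x \<one> \<noteq> z \<one>" by (rule two_letters) metis
  have "\<exists>y\<in>X. (\<forall>t\<in>{\<one>}. y t = x t) \<and> (\<forall>t\<in>B. y t = z t)"
  proof (rule glue)
    fix s k assume s: "s \<in> {\<one>}" and k: "k \<in> K"
    have "k \<in> carrier G" "k \<in> S" using k K_carrier K_subset_S by blast+
    then have "s \<otimes> k \<in> S" using s by simp
    then show "s \<otimes> k \<notin> B" using assms(2) by blast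
  qed (use assms x in auto)
  then obtain y where y: "y \<in> X" "y \<one> = x \<one>" "\<forall>t\<in>B. y t = z t" by auto
  have "restrict y S \<one> \<noteq> restrict z S \<one>" using x y one_in_S by simp
  then have "restrict y S \<noteq> restrict z S" by metis
  moreover have "restrict y S \<in> fill B z" using y unfolding fill_def by auto
  ultimately show thesis using that by metis
qed

text \<open>Eliminating \<open>e\<close> from \<open>e \<rho> i = \<rho> j k\<close> and
  \<open>e \<rho> i' = \<rho> j' k'\<close> expresses the term of largest index by earlier ones in
  this form. Allowing \<open>\<one>\<close> covers the shorter relations.\<close>

definition forb :: "'g set \<Rightarrow> 'g set \<Rightarrow> 'g set" where
  "forb V P = (\<lambda>(a, k, b, c, l). a \<otimes> k \<otimes> (inv b \<otimes> (c \<otimes> l))) `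
     (insert \<one> P \<times> V \<times> insert \<one> P \<times> insert \<one> P \<times> V)"

lemma forbI:
  "a \<in> insert \<one> P \<Longrightarrow> k \<in> V \<Longrightarrow> b \<in> insert \<one> P \<Longrightarrow> c \<in> insert \<one> P \<Longrightarrow> l \<in> V
    \<Longrightarrow> a \<otimes> k \<otimes> (inv b \<otimes> (c \<otimes> l)) \<in> forb V P"
  unfolding forb_def by (rule image_eqI[where x = "(a, k, b, c, l)"]) auto

lemma finite_forb: "finite V \<Longrightarrow> finite P \<Longrightarrow> finite (forb V P)"
  by (simp add: forb_def)

lemma sparse_sequence:
  assumes "finite V" "infinite Y"
  obtains \<rho> :: "nat \<Rightarrow> 'g" where "\<And>n. \<rho> n \<in> Y" "\<And>n. \<rho> n \<notin> forb V (\<rho> ` {..<n})"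
proof -
  have "\<exists>\<rho>. \<forall>n::nat. \<rho> n \<in> Y \<and> \<rho> n \<notin> forb V (\<rho> ` {..<n})"
  proof (rule dependent_wf_choice[where R = less_than])
    fix f g :: "nat \<Rightarrow> 'g" and n r
    assume "\<And>i. (i, n) \<in> less_than \<Longrightarrow> f i = g i"
    then have "f ` {..<n} = g ` {..<n}" by (intro image_cong) auto
    then show "(r \<in> Y \<and> r \<notin> forb V (f ` {..<n})) = (r \<in> Y \<and> r \<notin> forb V (g ` {..<n}))" by simp
  next
    fix n and f :: "nat \<Rightarrow> 'g"
    have "infinite (Y - forb V (f ` {..<n}))"
      using assms finite_forb by (intro Diff_infinite_finite) auto
    then have "Y - forb V (f ` {..<n}) \<noteq> {}" by (metis finite.emptyI)
    then obtain r where "r \<in> Y - forb V (f ` {..<n})" by blast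
    then show "\<exists>r. r \<in> Y \<and> r \<notin> forb V (f ` {..<n})" by blast
  qed simp
  then show thesis using that by blast
qed

end

text \<open>In the application \<open>U\<close> is \<open>D K\<close> for the finite set
  \<open>D\<close> of cells already prescribed.\<close>

locale sparse = si_shift G A X K
  for G :: "('g, 'm) monoid_scheme" (structure) and A :: "'a set" and X :: "('g \<Rightarrow> 'a) set"
    and K :: "'g set" +
  fixes Y U V :: "'g set" and \<rho> :: "nat \<Rightarrow> 'g"
  assumes finite_U: "finite U" and U_carrier: "U \<subseteq> carrier G" and K_subset_U: "K \<subseteq> U"
    and Y_carrier: "Y \<subseteq> carrier G"
    and const_or_inj: "\<And>k. k \<in> K \<Longrightarrow> inj_on (\<lambda>r. r \<otimes> k \<otimes> inv r) Y \<or>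
        (\<forall>r\<in>Y. \<forall>s\<in>Y. r \<otimes> k \<otimes> inv r = s \<otimes> k \<otimes> inv s)"
    and V_def: "V = U \<union> (\<lambda>u. inv u) ` U"
    and rho_Y: "\<And>n. \<rho> n \<in> Y" and rho_sparse: "\<And>n. \<rho> n \<notin> forb V (\<rho> ` {..<n})"
begin

lemma rho_carrier [simp]: "\<rho> n \<in> carrier G"
  using rho_Y Y_carrier by blast

lemma U_V: "u \<in> U \<Longrightarrow> u \<in> V" "u \<in> U \<Longrightarrow> inv u \<in> V"
  by (auto simp: V_def)

lemma K_V: "k \<in> K \<Longrightarrow> k \<in> V" "k \<in> K \<Longrightarrow> inv k \<in> V"
  using K_subset_U U_V by auto

lemma one_V: "\<one> \<in> V" using K_V one_in_K by blast

lemma K_in_carrier: "k \<in> K \<Longrightarrow> k \<in> carrier G" using K_carrier by blast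

lemma rho_neq_quotient:
  assumes "i < j" "u \<in> V" "v \<in> V" "u \<in> carrier G" "v \<in> carrier G"
  shows "\<rho> j \<noteq> \<rho> i \<otimes> u \<otimes> v"
  using forbI[of "\<rho> i" "\<rho> ` {..<j}" u V \<one> \<one> v] rho_sparse[of j] assms by auto

lemma rho_notin_U: "\<rho> j \<notin> U"
proof
  assume "\<rho> j \<in> U"
  then have "\<one> \<otimes> \<one> \<otimes> (inv \<one> \<otimes> (\<one> \<otimes> \<rho> j)) \<in> forb V (\<rho> ` {..<j})"
    using one_V U_V by (intro forbI) auto
  then show False using rho_sparse[of j] by simp
qed

lemma rho_notin_K: "i < j \<Longrightarrow> k \<in> K \<Longrightarrow> \<rho> i \<otimes> k \<noteq> \<rho> j"
  using rho_neq_quotient[of i j k \<one>] K_V one_V K_in_carrier by auto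

lemma inj_rho: "inj \<rho>"
proof (rule linorder_injI)
  fix i j :: nat assume "i < j"
  then show "\<rho> i \<noteq> \<rho> j" using rho_notin_K[of i j \<one>] one_in_K by simp
qed

text \<open>The three cases in which the letter at \<open>e \<otimes> \<rho> i\<close> may fail to
  be free: the cell is close to the prescribed cells, to \<open>\<rho> i\<close> itself, or to
  another \<open>\<rho> j\<close>.\<close>

definition "bad1 m e = {i. i < m \<and> e \<otimes> \<rho> i \<in> U}"
definition "bad2 m e = {i. i < m \<and> (\<exists>k\<in>K. e \<otimes> \<rho> i = \<rho> i \<otimes> k)}"
definition "bad3 m e = {i. i < m \<and> (\<exists>j<m. j \<noteq> i \<and> (\<exists>k\<in>K. e \<otimes> \<rho> i = \<rho> j \<otimes> k))}"

text \<open>Two such indices \<open>i < j\<close> would make \<open>\<rho> j\<close> a product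
  \<open>\<rho> i u v\<close> with \<open>u\<close> and \<open>v\<close> in
  \<open>V\<close>.\<close>

lemma bad1_card:
  assumes e: "e \<in> carrier G"
  shows "card (bad1 m e) \<le> 1"
proof -
  have *: False if "i < j" "e \<otimes> \<rho> i \<in> U" "e \<otimes> \<rho> j \<in> U" for i j
  proof -
    have "\<rho> j = \<rho> i \<otimes> inv (e \<otimes> \<rho> i) \<otimes> (e \<otimes> \<rho> j)" using e by (simp add: gsimps)
    then show False
      using rho_neq_quotient[OF that(1) U_V(2)[OF that(2)] U_V(1)[OF that(3)]] e by simp
  qed
  have "\<forall>i\<in>bad1 m e. \<forall>j\<in>bad1 m e. i = j"
    using * unfolding bad1_def by (metis (no_types, lifting) linorder_neqE_nat mem_Collect_eq)
  then show ?thesis by (simp add: card_le_Suc0_iff_eq bad1_def)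
qed

text \<open>Here \<open>e\<close> is the conjugate of some \<open>\<kappa> i \<in> K\<close> by
  \<open>\<rho> i\<close>. If that conjugate is constant on \<open>Y\<close>, then \<open>e\<close>
  is one of the excluded elements; otherwise it determines \<open>\<rho> i\<close>. So
  \<open>\<kappa>\<close> is injective.\<close>

lemma bad2_card:
  assumes e: "e \<in> carrier G" "y \<in> Y" "e \<notin> (\<lambda>k. y \<otimes> k \<otimes> inv y) ` K"
  shows "card (bad2 m e) \<le> card K"
proof -
  have "\<forall>i\<in>bad2 m e. \<exists>k. k \<in> K \<and> e \<otimes> \<rho> i = \<rho> i \<otimes> k" by (auto simp: bad2_def)
  from bchoice[OF this] obtain \<kappa>
    where \<kappa>: "\<And>i. i \<in> bad2 m e \<Longrightarrow> \<kappa> i \<in> K \<and> e \<otimes> \<rho> i = \<rho> i \<otimes> \<kappa> i" by blast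
  have conj: "\<rho> i \<otimes> \<kappa> i \<otimes> inv (\<rho> i) = e" if "i \<in> bad2 m e" for i
    using \<kappa>[OF that, THEN conjunct2, symmetric] e by (simp add: m_assoc)
  have "inj_on \<kappa> (bad2 m e)"
  proof (rule inj_onI)
    fix i j assume i: "i \<in> bad2 m e" and j: "j \<in> bad2 m e" and eq: "\<kappa> i = \<kappa> j"
    have k: "\<kappa> i \<in> K" using \<kappa>[OF i] by blast
    have "\<not> (\<forall>r\<in>Y. \<forall>s\<in>Y. r \<otimes> \<kappa> i \<otimes> inv r = s \<otimes> \<kappa> i \<otimes> inv s)"
    proof
      assume "\<forall>r\<in>Y. \<forall>s\<in>Y. r \<otimes> \<kappa> i \<otimes> inv r = s \<otimes> \<kappa> i \<otimes> inv s"
      then have "e = y \<otimes> \<kappa> i \<otimes> inv y" using conj[OF i] rho_Y[of i] e(2) by metis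
      then show False using e(3) k by blast
    qed
    then have "inj_on (\<lambda>r. r \<otimes> \<kappa> i \<otimes> inv r) Y" using const_or_inj[OF k] by blast
    then have "\<rho> i = \<rho> j" using conj[OF i] conj[OF j] eq rho_Y by (simp add: inj_on_def)
    then show "i = j" using inj_rho by (simp add: inj_eq)
  qed
  moreover have "\<kappa> ` bad2 m e \<subseteq> K" using \<kappa> by blast
  ultimately show ?thesis using finite_K by (rule card_inj_on_le)
qed

text \<open>Two such coincidences determine each other unless they involve the same largest index.\<close>
lemma bad3_card:
  assumes e: "e \<in> carrier G"
  shows "card (bad3 m e) \<le> 2"
proof -
  define R where "R i j \<longleftrightarrow> i < m \<and> j < m \<and> j \<noteq> i \<and> (\<exists>k\<in>K. e \<otimes> \<rho> i = \<rho> j \<otimes> k)" for i j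
  \<comment> \<open>The relation with the smaller indices expresses \<open>e\<close> by earlier
    terms; substituted into the other, it puts the term of index \<open>max i j\<close> into its
    forbidden set.\<close>
  have clash: False if ij: "R i j" and ij': "R i' j'" and lt: "max i' j' < max i j" for i j i' j'
  proof -
    obtain k where k: "k \<in> K" "e \<otimes> \<rho> i = \<rho> j \<otimes> k" using ij by (auto simp: R_def)
    obtain k' where k': "k' \<in> K" "e \<otimes> \<rho> i' = \<rho> j' \<otimes> k'" using ij' by (auto simp: R_def)
    note kc = K_in_carrier[OF k(1)] K_in_carrier[OF k'(1)]
    have "e = e \<otimes> \<rho> i' \<otimes> inv (\<rho> i')" using e by (simp add: m_assoc)
    then have e': "e = \<rho> j' \<otimes> k' \<otimes> inv (\<rho> i')" unfolding k'(2) .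
    have "i \<noteq> j" using ij by (simp add: R_def)
    then consider "j < i" | "i < j" by linarith
    then show False
    proof cases
      case 1
      have "\<rho> i' \<otimes> inv k' \<otimes> (inv (\<rho> j') \<otimes> (\<rho> j \<otimes> k)) \<in> forb V (\<rho> ` {..<i})"
        using 1 lt k k' K_V by (intro forbI) auto
      moreover have "\<rho> i' \<otimes> inv k' \<otimes> (inv (\<rho> j') \<otimes> (\<rho> j \<otimes> k)) = \<rho> i"
        unfolding k(2)[symmetric] using kc by (simp add: e' gsimps)
      ultimately show False using rho_sparse[of i] by simp
    next
      case 2
      have "\<rho> j' \<otimes> k' \<otimes> (inv (\<rho> i') \<otimes> (\<rho> i \<otimes> inv k)) \<in> forb V (\<rho> ` {..<j})"
        using 2 lt k k' K_V by (intro forbI) auto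
      moreover have "\<rho> j' \<otimes> k' \<otimes> (inv (\<rho> i') \<otimes> (\<rho> i \<otimes> inv k)) = e \<otimes> \<rho> i \<otimes> inv k"
        using kc by (simp add: e' gsimps)
      moreover have "e \<otimes> \<rho> i \<otimes> inv k = \<rho> j" unfolding k(2) using kc by (simp add: gsimps)
      ultimately show False using rho_sparse[of j] by simp
    qed
  qed
  show ?thesis
  proof (cases "\<exists>i j. R i j")
    case False
    then have "bad3 m e = {}" by (auto simp: bad3_def R_def)
    then show ?thesis by simp
  next
    case True
    then obtain i0 j0 where R0: "R i0 j0" by blast
    define n where "n = max i0 j0"
    have max_eq: "max i j = n" if "R i j" for i j
      using clash[OF that R0] clash[OF R0 that] unfolding n_def by (metis linorder_neqE_nat)
    \<comment> \<open>All coincidences share the largest index \<open>n\<close>: either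
      \<open>i = n\<close>, or \<open>j = n\<close> and \<open>i \<in> L\<close>. Two elements
      \<open>i < j\<close> of \<open>L\<close> would give \<open>\<rho> j = \<rho> i k^-1 l\<close>,
      so the bound is 1 + 1.\<close>
    define L where "L = {i. i < m \<and> (\<exists>k\<in>K. e \<otimes> \<rho> i = \<rho> n \<otimes> k)}"
    have "bad3 m e \<subseteq> insert n L"
    proof
      fix i assume "i \<in> bad3 m e"
      then obtain j where ij: "R i j" by (auto simp: bad3_def R_def)
      then have "i = n \<or> j = n" using max_eq by (metis max_def)
      then show "i \<in> insert n L" using ij by (auto simp: R_def L_def)
    qed
    moreover have "card L \<le> 1"
    proof -
      have *: False if ij: "i < j" and k: "k \<in> K" "e \<otimes> \<rho> i = \<rho> n \<otimes> k"
        and l: "l \<in> K" "e \<otimes> \<rho> j = \<rho> n \<otimes> l" for i j k l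
      proof -
        note kc = K_in_carrier[OF k(1)] K_in_carrier[OF l(1)]
        have "\<rho> n = e \<otimes> \<rho> i \<otimes> inv k" unfolding k(2) using kc by (simp add: m_assoc)
        then have en: "inv e \<otimes> \<rho> n = \<rho> i \<otimes> inv k" using e kc by (simp add: m_assoc)
        have "\<rho> j = inv e \<otimes> (\<rho> n \<otimes> l)" unfolding l(2)[symmetric] using e by simp
        also have "\<dots> = inv e \<otimes> \<rho> n \<otimes> l" using e kc by (simp add: m_assoc)
        finally have "\<rho> j = \<rho> i \<otimes> inv k \<otimes> l" unfolding en .
        then show False
          using rho_neq_quotient[OF ij K_V(2)[OF k(1)] K_V(1)[OF l(1)]] kc by simp
      qed
      have "\<forall>i\<in>L. \<forall>j\<in>L. i = j"
      proof (intro ballI)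
        fix i j assume "i \<in> L" "j \<in> L"
        then obtain k l where kl: "k \<in> K" "e \<otimes> \<rho> i = \<rho> n \<otimes> k" "l \<in> K" "e \<otimes> \<rho> j = \<rho> n \<otimes> l"
          by (auto simp: L_def)
        show "i = j"
          using *[OF _ kl] *[OF _ kl(3,4,1,2)] by (meson nat_neq_iff)
      qed
      then show ?thesis by (simp add: card_le_Suc0_iff_eq L_def)
    qed
    moreover have "finite L" by (simp add: L_def)
    ultimately have "card (bad3 m e) \<le> card (insert n L)" by (intro card_mono) auto
    also have "\<dots> \<le> 2" using \<open>card L \<le> 1\<close> card_insert_le_m1[of 2 L n] by simp
    finally show ?thesis .
  qed
qed

lemma bad_card:
  assumes e: "e \<in> carrier G" "y \<in> Y" "e \<notin> (\<lambda>k. y \<otimes> k \<otimes> inv y) ` K"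
  shows "card (bad1 m e \<union> bad2 m e \<union> bad3 m e) \<le> card K + 3"
proof -
  have "card (bad1 m e \<union> bad2 m e \<union> bad3 m e) \<le> card (bad1 m e) + card (bad2 m e) + card (bad3 m e)"
    by (meson add_right_mono card_Un_le order_trans)
  then show ?thesis using bad1_card[OF e(1), of m] bad2_card[OF e, of m] bad3_card[OF e(1), of m] by simp
qed

text \<open>The letters go in one at a time: \<open>\<rho> m\<close> avoids the products with
  \<open>K\<close> of \<open>D\<close> and of the earlier terms, so gluing leaves its letter
  free.\<close>

lemma free_pattern:
  assumes D: "finite D" "D \<subseteq> carrier G" "\<And>d k. d \<in> D \<Longrightarrow> k \<in> K \<Longrightarrow> d \<otimes> k \<in> U"
    and xyz: "x \<in> X" "y \<in> X" "z \<in> X"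
    and w: "\<And>i. i < m \<Longrightarrow> w i = x \<one> \<or> w i = y \<one>"
  shows "\<exists>u\<in>X. (\<forall>d\<in>D. u d = z d) \<and> (\<forall>i<m. u (\<rho> i) = w i)"
  using w
proof (induction m)
  case 0
  then show ?case using xyz by blast
next
  case (Suc m)
  then obtain u where u: "u \<in> X" "\<forall>d\<in>D. u d = z d" "\<forall>i<m. u (\<rho> i) = w i" by auto
  obtain v where v: "v \<in> X" "v \<one> = w m" using Suc.prems[of m] xyz by auto
  have "\<exists>u'\<in>X. (\<forall>t\<in>D \<union> \<rho> ` {..<m}. u' t = u t) \<and> (\<forall>t\<in>{\<rho> m}. u' t = lshift G (\<rho> m) v t)"
  proof (rule glue)
    fix s k assume s: "s \<in> D \<union> \<rho> ` {..<m}" and k: "k \<in> K"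
    show "s \<otimes> k \<notin> {\<rho> m}"
      using s D(3)[OF _ k, of s] rho_notin_U[of m] rho_notin_K[OF _ k] by auto
  qed (use D u v lshift_in_X in auto)
  then obtain u' where u': "u' \<in> X" "\<forall>t\<in>D \<union> \<rho> ` {..<m}. u' t = u t" "u' (\<rho> m) = v \<one>"
    by (auto simp: lshift_apply)
  then have "(\<forall>d\<in>D. u' d = z d) \<and> (\<forall>i<Suc m. u' (\<rho> i) = w i)"
    using u v by (simp add: less_Suc_eq)
  then show ?case using u'(1) by blast
qed

end

section \<open>Central automorphisms\<close>

context sparse
begin

text \<open>The values to be avoided are read off the fixed point \<open>z\<close> before the word
  is chosen, which prevents circularity. Once the word disagrees with
  \<open>z (e \<otimes> \<rho> i)\<close> at an index that is not bad, \<open>z\<close> is glued in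
  at \<open>e \<otimes> \<rho> i\<close>.\<close>

lemma isolated_pattern:
  assumes D: "finite D" "D \<subseteq> carrier G" "S \<subseteq> D" "\<And>d k. d \<in> D \<Longrightarrow> k \<in> K \<Longrightarrow> d \<otimes> k \<in> U"
    and z: "z \<in> X" and y: "y \<in> Y"
  shows "\<exists>m. \<exists>u\<in>X. (\<forall>d\<in>D. u d = z d) \<and>
    (\<forall>e\<in>offsets (D \<union> \<rho> ` {..<m}) - (\<lambda>k. y \<otimes> k \<otimes> inv y) ` K.
      \<exists>i<m. e \<otimes> \<rho> i \<notin> S \<and> u (e \<otimes> \<rho> i) \<noteq> u (\<rho> i))"
proof -
  obtain m where m: "(card D + m) ^ 4 * 2 ^ (card K + 3) < (2::nat) ^ m"
    using exponential_beats_quartic by blast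
  define D' where "D' = D \<union> \<rho> ` {..<m}"
  define Es where "Es = offsets D' - (\<lambda>k. y \<otimes> k \<otimes> inv y) ` K"
  have D': "finite D'" "D' \<subseteq> carrier G" using D by (auto simp: D'_def)
  have finEs: "finite Es" using finite_offsets[OF D'(1)] by (simp add: Es_def)
  have Es_carrier: "e \<in> carrier G" if "e \<in> Es" for e
    using offsets_carrier[OF D'(2)] that by (auto simp: Es_def)
  have "card D' \<le> card D + m"
    using card_Un_le[of D "\<rho> ` {..<m}"] card_image_le[of "{..<m}" \<rho>] by (simp add: D'_def)
  have "card Es \<le> card (offsets D')"
    unfolding Es_def by (intro card_mono finite_offsets D'(1)) auto
  also have "\<dots> \<le> card D' ^ 4" by (rule card_offsets[OF D'(1)])
  also have "\<dots> \<le> (card D + m) ^ 4" using \<open>card D' \<le> card D + m\<close> by (rule power_mono) simp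
  finally have "card Es * 2 ^ (card K + 3) \<le> (card D + m) ^ 4 * 2 ^ (card K + 3)"
    by (rule mult_right_mono) simp
  then have small: "card Es * 2 ^ (card K + 3) < 2 ^ m" using m by (rule le_less_trans)
  define bad where "bad e = bad1 m e \<union> bad2 m e \<union> bad3 m e" for e
  have bad: "bad e \<subseteq> {..<m} \<and> card (bad e) \<le> card K + 3" if "e \<in> Es" for e
  proof
    show "bad e \<subseteq> {..<m}" by (auto simp: bad_def bad1_def bad2_def bad3_def)
    show "card (bad e) \<le> card K + 3"
      unfolding bad_def by (rule bad_card[OF Es_carrier[OF that] y]) (use that in \<open>simp add: Es_def\<close>)
  qed
  obtain xa xb where ab: "xa \<in> X" "xb \<in> X" "xa \<one> \<noteq> xb \<one>" by (rule two_letters)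
  have "\<exists>w. (\<forall>i<m. w i = xa \<one> \<or> w i = xb \<one>)
      \<and> (\<forall>e\<in>Es. \<exists>i<m. i \<notin> bad e \<and> w i \<noteq> z (e \<otimes> \<rho> i))"
    by (rule exists_word_avoiding[OF finEs bad ab(3) small])
  then obtain w where w: "\<forall>i<m. w i = xa \<one> \<or> w i = xb \<one>"
    "\<forall>e\<in>Es. \<exists>i<m. i \<notin> bad e \<and> w i \<noteq> z (e \<otimes> \<rho> i)" by (elim exE conjE)
  obtain v where v: "v \<in> X" "\<forall>d\<in>D. v d = z d" "\<forall>i<m. v (\<rho> i) = w i"
    using free_pattern[OF D(1,2,4) ab(1,2) z, of m w] w(1) by auto
  \<comment> \<open>Values of \<open>z\<close> can be enforced only outside \<open>D' K\<close>; for
    an index that is not bad, \<open>e \<otimes> \<rho> i\<close> is such a cell.\<close>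
  define T where "T = (\<lambda>(e, i). e \<otimes> \<rho> i) ` (Es \<times> {..<m}) - (\<lambda>(p, k). p \<otimes> k) ` (D' \<times> K)"
  have "\<exists>u\<in>X. (\<forall>t\<in>D'. u t = v t) \<and> (\<forall>t\<in>T. u t = z t)"
  proof (rule glue)
    show "finite T" using finEs by (simp add: T_def)
    show "T \<subseteq> carrier G" using Es_carrier by (auto simp: T_def)
    show "s \<otimes> k \<notin> T" if "s \<in> D'" "k \<in> K" for s k
      using that unfolding T_def by (force simp: image_iff)
  qed (use D' v z in auto)
  then obtain u where u: "u \<in> X" "\<And>t. t \<in> D' \<Longrightarrow> u t = v t" "\<And>t. t \<in> T \<Longrightarrow> u t = z t" by blast
  show ?thesis
  proof (rule exI[of _ m], rule bexI[of _ u], intro conjI ballI)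
    show "u \<in> X" by (fact u(1))
    show "u d = z d" if "d \<in> D" for d using that u(2)[of d] v(2) by (simp add: D'_def)
    fix e assume "e \<in> offsets (D \<union> \<rho> ` {..<m}) - (\<lambda>k. y \<otimes> k \<otimes> inv y) ` K"
    then have e: "e \<in> Es" by (simp add: Es_def D'_def)
    obtain i where i: "i < m" "i \<notin> bad e" "w i \<noteq> z (e \<otimes> \<rho> i)" using w(2) e by blast
    have notU: "e \<otimes> \<rho> i \<notin> U" using i by (auto simp: bad_def bad1_def)
    have "e \<otimes> \<rho> i \<noteq> p \<otimes> k" if p: "p \<in> D'" and k: "k \<in> K" for p k
    proof (cases "p \<in> D")
      case True
      then show ?thesis using D(4)[OF True k] notU by auto
    next
      case False
      then obtain j where j: "j < m" "p = \<rho> j" using p by (auto simp: D'_def)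
      show ?thesis
      proof
        assume eq: "e \<otimes> \<rho> i = p \<otimes> k"
        show False
        proof (cases "j = i")
          case True
          then have "i \<in> bad2 m e" using eq i k j by (auto simp: bad2_def)
          then show False using i by (simp add: bad_def)
        next
          case False
          then have "i \<in> bad3 m e" using eq i k j by (auto simp: bad3_def)
          then show False using i by (simp add: bad_def)
        qed
      qed
    qed
    then have "e \<otimes> \<rho> i \<in> T" using e i by (auto simp: T_def)
    then have "u (e \<otimes> \<rho> i) = z (e \<otimes> \<rho> i)" by (rule u(3))
    moreover have "u (\<rho> i) = w i" using u(2)[of "\<rho> i"] v(3) i by (simp add: D'_def)
    moreover have "e \<otimes> \<rho> i \<notin> S"
    proof
      assume *: "e \<otimes> \<rho> i \<in> S"
      then have "e \<otimes> \<rho> i \<otimes> \<one> \<in> U" using D(3) one_in_K by (intro D(4)) auto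
      then show False using notU Es_carrier[OF e] by simp
    qed
    ultimately show "\<exists>i<m. e \<otimes> \<rho> i \<notin> S \<and> u (e \<otimes> \<rho> i) \<noteq> u (\<rho> i)"
      using i by metis
  qed
qed

end

section \<open>Existence of markers and rigidity of central maps\<close>

context si_shift
begin

text \<open>\<open>F\<close> collects the displacements that counting cannot handle and is chosen
  before \<open>B\<close> and \<open>z\<close>, so they can be broken in advance. Having
  \<open>e \<otimes> d \<in> B\<close> keeps the disagreement in every extension and outside
  \<open>S\<close>.\<close>

lemma marker_exists:
  "\<exists>F. finite F \<and> F \<subseteq> carrier G \<and>
    (\<forall>B z. finite B \<longrightarrow> B \<subseteq> carrier G - S \<longrightarrow> z \<in> X \<longrightarrow>
      (\<forall>e\<in>F - N. \<exists>d\<in>B. e \<otimes> d \<in> B \<and> z (e \<otimes> d) \<noteq> z d) \<longrightarrow>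
      (\<exists>B' z' q. B \<subseteq> B' \<and> (\<forall>d\<in>B. z' d = z d) \<and> marker G A X K B' z' q))"
proof -
  obtain Y where Y: "Y \<subseteq> carrier G" "infinite Y"
    "\<forall>k\<in>K. inj_on (\<lambda>r. r \<otimes> k \<otimes> inv r) Y \<or> (\<forall>r\<in>Y. \<forall>s\<in>Y. r \<otimes> k \<otimes> inv r = s \<otimes> k \<otimes> inv s)"
    using infinite_subset_const_or_inj[OF finite_K infinite_G, of "\<lambda>k r. r \<otimes> k \<otimes> inv r"] by blast
  from Y(2) obtain y where y: "y \<in> Y" by (metis ex_in_conv finite.emptyI)
  define F where "F = (\<lambda>k. y \<otimes> k \<otimes> inv y) ` K"
  show ?thesis
  proof (rule exI[of _ F], intro conjI allI impI)
    show "finite F" using finite_K by (simp add: F_def)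
    show "F \<subseteq> carrier G" using Y(1) y K_carrier by (auto simp: F_def)
    fix B z
    assume B: "finite B" "B \<subseteq> carrier G - S" and z: "z \<in> X"
      and br: "\<forall>e\<in>F - N. \<exists>d\<in>B. e \<otimes> d \<in> B \<and> z (e \<otimes> d) \<noteq> z d"
    \<comment> \<open>Minimality comes before isolation: it survives the addition of sparse cells,
      whereas isolation must hold for the offsets of the final support.\<close>
    obtain B1 z1 where B1: "finite B1" "B \<subseteq> B1" "B1 \<subseteq> carrier G - S" "z1 \<in> X"
      "\<And>d. d \<in> B \<Longrightarrow> z1 d = z d" "minimal B1 z1"
      using minimal_exists[OF B z] by metis
    define D where "D = S \<union> B1"
    define U where "U = (\<lambda>(d, k). d \<otimes> k) ` (D \<times> K)"
    define V where "V = U \<union> (\<lambda>u. inv u) ` U"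
    have D: "finite D" "D \<subseteq> carrier G" "S \<subseteq> D"
      using B1 finite_S S_carrier by (auto simp: D_def)
    have DK: "d \<otimes> k \<in> U" if "d \<in> D" "k \<in> K" for d k
      unfolding U_def by (rule image_eqI[where x = "(d, k)"]) (use that in auto)
    have U: "finite U" "U \<subseteq> carrier G" using D finite_K K_carrier by (auto simp: U_def)
    have "K \<subseteq> U"
    proof
      fix k assume k: "k \<in> K"
      then have "\<one> \<otimes> k \<in> U" using one_in_S D(3) by (intro DK) auto
      then show "k \<in> U" using k K_carrier by auto
    qed
    have "finite V" using U by (simp add: V_def)
    then obtain \<rho> :: "nat \<Rightarrow> 'g" where \<rho>: "\<And>n. \<rho> n \<in> Y" "\<And>n. \<rho> n \<notin> forb V (\<rho> ` {..<n})"
      using sparse_sequence[OF _ Y(2)] by metis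
    interpret sparse G A X K Y U V \<rho>
      by unfold_locales (use U \<open>K \<subseteq> U\<close> Y \<rho> in \<open>simp_all add: V_def\<close>)
    have "\<exists>m. \<exists>u\<in>X. (\<forall>d\<in>D. u d = z1 d) \<and>
      (\<forall>e\<in>offsets (D \<union> \<rho> ` {..<m}) - F. \<exists>i<m. e \<otimes> \<rho> i \<notin> S \<and> u (e \<otimes> \<rho> i) \<noteq> u (\<rho> i))"
      unfolding F_def by (rule isolated_pattern[OF D _ B1(4) y]) (rule DK)
    then obtain m u where u: "u \<in> X" "\<forall>d\<in>D. u d = z1 d"
      "\<forall>e\<in>offsets (D \<union> \<rho> ` {..<m}) - F. \<exists>i<m. e \<otimes> \<rho> i \<notin> S \<and> u (e \<otimes> \<rho> i) \<noteq> u (\<rho> i)"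
      by (elim exE bexE conjE)
    define B' where "B' = B1 \<union> \<rho> ` {..<m}"
    have "\<rho> i \<notin> S" for i
    proof
      assume *: "\<rho> i \<in> S"
      then have "\<rho> i \<otimes> \<one> \<in> U" using D(3) one_in_K by (intro DK) auto
      then show False using rho_notin_U[of i] by simp
    qed
    then have B': "finite B'" "B' \<subseteq> carrier G - S" using B1 by (auto simp: B'_def)
    have ext: "u d = z d" if "d \<in> B" for d
      using u(2) B1(2,5) that by (auto simp: D_def)
    have min: "minimal B' u"
      by (rule minimal_extend[OF B1(6) _ B' u(1)]) (use u(2) in \<open>auto simp: B'_def D_def\<close>)
    have iso: "\<exists>d\<in>B'. e \<otimes> d \<notin> S \<and> u (e \<otimes> d) \<noteq> u d" if e: "e \<in> offsets (S \<union> B')" "e \<notin> N" for e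
    proof (cases "e \<in> F")
      case True
      then obtain d where d: "d \<in> B" "e \<otimes> d \<in> B" "z (e \<otimes> d) \<noteq> z d" using br e by blast
      then have "u (e \<otimes> d) \<noteq> u d" using ext by simp
      moreover have "d \<in> B'" "e \<otimes> d \<notin> S" using d B1(2) B(2) by (auto simp: B'_def)
      ultimately show ?thesis by blast
    next
      case False
      have "S \<union> B' = D \<union> \<rho> ` {..<m}" by (auto simp: B'_def D_def)
      then obtain i where i: "i < m" "e \<otimes> \<rho> i \<notin> S" "u (e \<otimes> \<rho> i) \<noteq> u (\<rho> i)"
        using u(3) False e(1) by (metis DiffI)
      then show ?thesis by (intro bexI[of _ "\<rho> i"]) (auto simp: B'_def)
    qed
    obtain q where q: "q \<in> fill B' u" "q \<noteq> restrict u S" by (rule other_filling[OF B' u(1)])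
    have "marker G A X K B' u q"
      by unfold_locales (use B' u(1) min iso q in auto)
    then show "\<exists>B' z' q. B \<subseteq> B' \<and> (\<forall>d\<in>B. z' d = z d) \<and> marker G A X K B' z' q"
      using ext B1(2) by (intro exI[of _ B'] exI[of _ u] exI[of _ q]) (auto simp: B'_def)
  qed
qed

text \<open>Each new condition is realised off the cells \<open>B K\<close> around those already
  used, so gluing preserves all of them; the last hypothesis says that \<open>\<Phi> C\<close>
  depends only on the values on \<open>C\<close>.\<close>

lemma glue_family:
  assumes "finite \<P>" "finite Z0"
    and "\<And>\<Phi> Z. \<Phi> \<in> \<P> \<Longrightarrow> finite Z \<Longrightarrow> \<exists>C x. finite C \<and> C \<subseteq> carrier G - Z \<and> x \<in> X \<and> \<Phi> C x"
    and "\<And>\<Phi> C x y. \<Phi> \<in> \<P> \<Longrightarrow> \<Phi> C x \<Longrightarrow> x \<in> X \<Longrightarrow> y \<in> X \<Longrightarrow> (\<And>t. t \<in> C \<Longrightarrow> y t = x t) \<Longrightarrow> \<Phi> C y"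
  shows "\<exists>B z. finite B \<and> B \<subseteq> carrier G - Z0 \<and> z \<in> X \<and> (\<forall>\<Phi>\<in>\<P>. \<exists>C\<subseteq>B. \<Phi> C z)"
  using assms
proof (induction \<P> rule: finite_induct)
  case empty
  obtain x where "x \<in> X" using nontrivial by blast
  then show ?case by (intro exI[of _ "{}"] exI[of _ x]) auto
next
  case (insert \<Phi> \<P>)
  have "\<exists>B z. finite B \<and> B \<subseteq> carrier G - Z0 \<and> z \<in> X \<and> (\<forall>\<Phi>\<in>\<P>. \<exists>C\<subseteq>B. \<Phi> C z)"
  proof (rule insert.IH[OF insert.prems(1)])
    show "\<exists>C x. finite C \<and> C \<subseteq> carrier G - Z \<and> x \<in> X \<and> \<Psi> C x" if "\<Psi> \<in> \<P>" "finite Z" for \<Psi> Z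
      using that by (intro insert.prems(2) insertI2)
    show "\<Psi> C y" if "\<Psi> \<in> \<P>" "\<Psi> C x" "x \<in> X" "y \<in> X" "\<And>t. t \<in> C \<Longrightarrow> y t = x t" for \<Psi> C x y
      by (rule insert.prems(3)[OF insertI2[OF that(1)] that(2-5)])
  qed
  then obtain B z where B: "finite B" "B \<subseteq> carrier G - Z0" and z: "z \<in> X"
    and old: "\<And>\<Psi>. \<Psi> \<in> \<P> \<Longrightarrow> \<exists>C\<subseteq>B. \<Psi> C z" by metis
  define Z where "Z = Z0 \<union> (\<lambda>(b, k). b \<otimes> k) ` (B \<times> K)"
  have "finite Z" using B insert.prems(1) finite_K by (simp add: Z_def)
  then have "\<exists>C x. finite C \<and> C \<subseteq> carrier G - Z \<and> x \<in> X \<and> \<Phi> C x"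
    by (rule insert.prems(2)[OF insertI1])
  then obtain C x where C: "finite C" "C \<subseteq> carrier G - Z" and x: "x \<in> X" "\<Phi> C x" by metis
  have "\<exists>u\<in>X. (\<forall>t\<in>B. u t = z t) \<and> (\<forall>t\<in>C. u t = x t)"
  proof (rule glue)
    fix s k assume "s \<in> B" "k \<in> K"
    then have "s \<otimes> k \<in> Z" unfolding Z_def by (intro UnI2 image_eqI[where x = "(s, k)"]) auto
    then show "s \<otimes> k \<notin> C" using C(2) by auto
  qed (use B C x z in auto)
  then obtain u where u: "u \<in> X" "\<And>t. t \<in> B \<Longrightarrow> u t = z t" "\<And>t. t \<in> C \<Longrightarrow> u t = x t" by metis
  have "\<exists>C'\<subseteq>B \<union> C. \<Psi> C' u" if "\<Psi> \<in> insert \<Phi> \<P>" for \<Psi>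
  proof (cases "\<Psi> = \<Phi>")
    case True
    then have "\<Psi> C u" using insert.prems(3)[OF insertI1 x(2) x(1) u(1) u(3)] by simp
    then show ?thesis by auto
  next
    case False
    then have \<Psi>: "\<Psi> \<in> \<P>" using that by simp
    then obtain C' where C': "C' \<subseteq> B" "\<Psi> C' z" using old by metis
    have "\<Psi> C' u"
      by (rule insert.prems(3)[OF insertI2[OF \<Psi>] C'(2) z u(1)]) (use u(2) C'(1) in auto)
    then show ?thesis using C'(1) by (intro exI[of _ C']) auto
  qed
  then show ?case
    using B C u(1) by (intro exI[of _ "B \<union> C"] exI[of _ u]) (auto simp: Z_def)
qed

text \<open>If a marker placed in \<open>z\<close> records, for every candidate \<open>a\<close>, a failure of \<open>f x (a h) = x h\<close>,
  then \<open>f\<close> cannot commute with the marker automorphism: toggling the marker in \<open>z\<close> forces \<open>f z\<close>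
  to contain the marker at some candidate \<open>a\<close>.\<close>
lemma commuting_is_cofinitely_lshift:
  assumes f: "\<And>x. x \<in> X \<Longrightarrow> f x \<in> X" and gf: "\<And>x. x \<in> X \<Longrightarrow> g (f x) = x"
    and M: "finite M" "M \<subseteq> carrier G"
    and memf: "\<And>x y t. x \<in> X \<Longrightarrow> y \<in> X \<Longrightarrow> t \<in> carrier G \<Longrightarrow>
      (\<And>m. m \<in> M \<Longrightarrow> x (t \<otimes> m) = y (t \<otimes> m)) \<Longrightarrow> f x t = f y t"
    and M': "finite M'" "M' \<subseteq> carrier G"
    and memg: "\<And>x y t. x \<in> X \<Longrightarrow> y \<in> X \<Longrightarrow> t \<in> carrier G \<Longrightarrow>
      (\<And>m. m \<in> M' \<Longrightarrow> x (t \<otimes> m) = y (t \<otimes> m)) \<Longrightarrow> g x t = g y t"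
    and comm: "\<And>\<phi> x. \<phi> \<in> carrier (Aut_shift G A X) \<Longrightarrow> x \<in> X \<Longrightarrow> f (\<phi> x) = \<phi> (f x)"
  shows "\<exists>a\<in>carrier G. finite {h \<in> carrier G. \<exists>x\<in>X. f x (a \<otimes> h) \<noteq> x h}"
proof (rule ccontr)
  assume "\<not> ?thesis"
  then have inf: "infinite {h \<in> carrier G. \<exists>x\<in>X. f x (a \<otimes> h) \<noteq> x h}" if "a \<in> carrier G" for a
    using that by blast
  \<comment> \<open>A marker at \<open>a\<close> whose exchange is seen by \<open>g\<close> at a
    cell \<open>t \<in> S\<close> covers some \<open>t \<otimes> m\<close> with
    \<open>m \<in> M'\<close>, that is, \<open>a = t m s'^-1\<close> with
    \<open>s' \<in> S\<close>.\<close>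
  define Q where "Q = (\<lambda>(s, m, s'). s \<otimes> m \<otimes> inv s') ` (S \<times> M' \<times> S)"
  have Q: "finite Q" "Q \<subseteq> carrier G" using finite_S M' S_carrier by (auto simp: Q_def)
  obtain F where F: "finite F" "F \<subseteq> carrier G"
    and mk: "\<forall>B z. finite B \<longrightarrow> B \<subseteq> carrier G - S \<longrightarrow> z \<in> X \<longrightarrow>
      (\<forall>e\<in>F - N. \<exists>d\<in>B. e \<otimes> d \<in> B \<and> z (e \<otimes> d) \<noteq> z d) \<longrightarrow>
      (\<exists>B' z' q. B \<subseteq> B' \<and> (\<forall>d\<in>B. z' d = z d) \<and> marker G A X K B' z' q)"
    using marker_exists by (elim exE conjE)
  \<comment> \<open>The memory cells \<open>a \<otimes> h \<otimes> m\<close> must lie in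
    \<open>C\<close> for the failure to depend on the values on \<open>C\<close> alone.\<close>
  define fails where "fails a C x \<longleftrightarrow>
    (\<exists>h\<in>C. h \<in> carrier G \<and> (\<forall>m\<in>M. a \<otimes> h \<otimes> m \<in> C) \<and> f x (a \<otimes> h) \<noteq> x h)" for a and C :: "'g set" and x
  define breaks where "breaks e C x \<longleftrightarrow> (\<exists>d\<in>C. e \<otimes> d \<in> C \<and> x (e \<otimes> d) \<noteq> x d)"
    for e and C :: "'g set" and x :: "'g \<Rightarrow> 'a"
  have fails_cong: "fails a C y"
    if "a \<in> Q" and fl: "fails a C x" and "x \<in> X" "y \<in> X" and eq: "\<And>t. t \<in> C \<Longrightarrow> y t = x t"
    for a C x y
  proof -
    obtain h where h: "h \<in> C" "h \<in> carrier G" "\<forall>m\<in>M. a \<otimes> h \<otimes> m \<in> C" "f x (a \<otimes> h) \<noteq> x h"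
      using fl by (auto simp: fails_def)
    have "f y (a \<otimes> h) = f x (a \<otimes> h)"
      by (rule memf) (use that h Q in auto)
    then show ?thesis using h eq[OF h(1)] unfolding fails_def by auto
  qed
  have breaks_cong: "breaks e C y" if "breaks e C x" "\<And>t. t \<in> C \<Longrightarrow> y t = x t" for e C x y
    using that unfolding breaks_def by auto
  have fails_ex: "\<exists>C x. finite C \<and> C \<subseteq> carrier G - Z \<and> x \<in> X \<and> fails a C x"
    if a: "a \<in> Q" and Z: "finite Z" for a Z
  proof -
    have ac: "a \<in> carrier G" using a Q by blast
    \<comment> \<open>Besides \<open>Z\<close> itself, this excludes every \<open>h\<close> with a
      memory cell \<open>a \<otimes> h \<otimes> m\<close> in \<open>Z\<close>.\<close>
    define Z' where "Z' = Z \<union> (\<lambda>(t, m). inv a \<otimes> t \<otimes> inv m) ` (Z \<times> M)"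
    have "finite Z'" using Z M by (simp add: Z'_def)
    then have "infinite ({h \<in> carrier G. \<exists>x\<in>X. f x (a \<otimes> h) \<noteq> x h} - Z')" using inf[OF ac] by simp
    then have "{h \<in> carrier G. \<exists>x\<in>X. f x (a \<otimes> h) \<noteq> x h} - Z' \<noteq> {}" by (metis finite.emptyI)
    then obtain h x where h: "h \<in> carrier G" "h \<notin> Z'" and x: "x \<in> X" "f x (a \<otimes> h) \<noteq> x h" by auto
    have "a \<otimes> h \<otimes> m \<notin> Z" if m: "m \<in> M" for m
    proof
      assume "a \<otimes> h \<otimes> m \<in> Z"
      then have "(\<lambda>(t, m). inv a \<otimes> t \<otimes> inv m) (a \<otimes> h \<otimes> m, m) \<in> Z'"
        unfolding Z'_def using m by (intro UnI2 imageI) auto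
      moreover have "m \<in> carrier G" using m M by blast
      ultimately show False using h ac by (simp add: m_assoc)
    qed
    moreover have "h \<notin> Z" using h by (simp add: Z'_def)
    ultimately have "insert h ((\<lambda>m. a \<otimes> h \<otimes> m) ` M) \<subseteq> carrier G - Z" using h ac M by auto
    moreover have "fails a (insert h ((\<lambda>m. a \<otimes> h \<otimes> m) ` M)) x"
      using h x unfolding fails_def by auto
    ultimately show ?thesis
      using M(1) x(1) by (intro exI[of _ "insert h ((\<lambda>m. a \<otimes> h \<otimes> m) ` M)"] exI[of _ x]) simp
  qed
  have breaks_ex: "\<exists>C x. finite C \<and> C \<subseteq> carrier G - Z \<and> x \<in> X \<and> breaks e C x"
    if e: "e \<in> F" "e \<notin> N" and Z: "finite Z" for e Z
  proof -
    have ec: "e \<in> carrier G" using e F by blast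
    \<comment> \<open>If \<open>x (e \<otimes> t)\<close> and \<open>x t\<close> differed only for
      \<open>t\<close> in this finite set, \<open>e\<close> would lie in \<open>N\<close>.\<close>
    have "finite (Z \<union> (\<lambda>t. inv e \<otimes> t) ` Z)" using Z by simp
    then obtain x t where x: "x \<in> X" and t: "t \<in> carrier G" "t \<notin> Z \<union> (\<lambda>t. inv e \<otimes> t) ` Z"
      and neq: "x (e \<otimes> t) \<noteq> x t"
      using N_if_cofinitely_fixed[OF ec] e(2) by metis
    have "e \<otimes> t \<notin> Z"
    proof
      assume "e \<otimes> t \<in> Z"
      then have "inv e \<otimes> (e \<otimes> t) \<in> (\<lambda>t. inv e \<otimes> t) ` Z" by (rule imageI)
      then show False using t ec by simp
    qed
    then have "{t, e \<otimes> t} \<subseteq> carrier G - Z" using t ec by auto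
    moreover have "breaks e {t, e \<otimes> t} x" using neq by (auto simp: breaks_def)
    ultimately show ?thesis using x by (intro exI[of _ "{t, e \<otimes> t}"] exI[of _ x]) simp
  qed
  have "\<exists>B z. finite B \<and> B \<subseteq> carrier G - S \<and> z \<in> X \<and> (\<forall>\<Phi>\<in>fails ` Q \<union> breaks ` (F - N). \<exists>C\<subseteq>B. \<Phi> C z)"
  proof (rule glue_family)
    show "finite (fails ` Q \<union> breaks ` (F - N))" using Q F by simp
    show "finite S" by (rule finite_S)
    show "\<exists>C x. finite C \<and> C \<subseteq> carrier G - Z \<and> x \<in> X \<and> \<Phi> C x"
      if "\<Phi> \<in> fails ` Q \<union> breaks ` (F - N)" "finite Z" for \<Phi> Z
      using that(1)
    proof
      assume "\<Phi> \<in> fails ` Q"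
      then obtain a where "a \<in> Q" "\<Phi> = fails a" by (rule imageE) auto
      then show ?thesis using fails_ex that(2) by simp
    next
      assume "\<Phi> \<in> breaks ` (F - N)"
      then obtain e where "e \<in> F" "e \<notin> N" "\<Phi> = breaks e" by (rule imageE) auto
      then show ?thesis using breaks_ex that(2) by simp
    qed
    show "\<Phi> C y"
      if "\<Phi> \<in> fails ` Q \<union> breaks ` (F - N)" "\<Phi> C x" "x \<in> X" "y \<in> X" "\<And>t. t \<in> C \<Longrightarrow> y t = x t"
      for \<Phi> C x y
      using that(1)
    proof
      assume "\<Phi> \<in> fails ` Q"
      then obtain a where a: "a \<in> Q" "\<Phi> = fails a" by (rule imageE) auto
      show ?thesis using that(2) fails_cong[OF a(1) _ that(3,4,5)] a(2) by simp
    next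
      assume "\<Phi> \<in> breaks ` (F - N)"
      then obtain e where e: "\<Phi> = breaks e" by (rule imageE) auto
      show ?thesis using that(2) breaks_cong[OF _ that(5)] e by simp
    qed
  qed
  then obtain B0 z0 where B0: "finite B0" "B0 \<subseteq> carrier G - S" "z0 \<in> X"
    and all: "\<And>\<Phi>. \<Phi> \<in> fails ` Q \<union> breaks ` (F - N) \<Longrightarrow> \<exists>C\<subseteq>B0. \<Phi> C z0" by metis
  have "\<forall>e\<in>F - N. \<exists>d\<in>B0. e \<otimes> d \<in> B0 \<and> z0 (e \<otimes> d) \<noteq> z0 d"
  proof
    fix e assume "e \<in> F - N"
    then have "breaks e \<in> fails ` Q \<union> breaks ` (F - N)" by simp
    then obtain C where "C \<subseteq> B0" "breaks e C z0" using all by metis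
    then show "\<exists>d\<in>B0. e \<otimes> d \<in> B0 \<and> z0 (e \<otimes> d) \<noteq> z0 d" unfolding breaks_def by auto
  qed
  then have "\<exists>B' z' q. B0 \<subseteq> B' \<and> (\<forall>d\<in>B0. z' d = z0 d) \<and> marker G A X K B' z' q"
    by (rule mk[THEN spec, THEN spec, THEN mp, THEN mp, THEN mp, THEN mp, OF B0])
  then obtain B z q where Bz: "B0 \<subseteq> B" "\<forall>d\<in>B0. z d = z0 d" and marker: "marker G A X K B z q"
    by (elim exE conjE)
  interpret marker G A X K B z q by (rule marker)
  obtain t where t: "t \<in> S" "mark z t \<noteq> z t" by (rule mark_z_neq)
  have tc: "t \<in> carrier G" using t S_carrier by simp
  \<comment> \<open>Applying \<open>g\<close> returns the change of \<open>z\<close> at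
    \<open>t\<close>, so by the memory of \<open>g\<close> the map \<open>mark\<close> changes
    \<open>f z\<close> at some \<open>t \<otimes> m\<close>. Hence \<open>f z\<close> has a marker
    at some \<open>a \<in> Q\<close>.\<close>
  have "f (mark z) = mark (f z)"
    using comm[OF mark_Aut z_in_X] f[OF z_in_X] z_in_X by simp
  then have "g (mark (f z)) = mark z" using gf[OF mark_in_X[OF z_in_X]] by simp
  then have "g (f z) t \<noteq> g (mark (f z)) t" using gf[OF z_in_X] t by simp
  then obtain m where m: "m \<in> M'" "mark (f z) (t \<otimes> m) \<noteq> f z (t \<otimes> m)"
    using memg[OF f[OF z_in_X] mark_in_X[OF f[OF z_in_X]] tc] by metis
  have mc: "m \<in> carrier G" using m M' by blast
  obtain a where a: "a \<in> occ (f z)" "inv a \<otimes> (t \<otimes> m) \<in> S"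
    using mark_neqE[OF _ m(2)] tc mc by auto
  have ac: "a \<in> carrier G" using a(1) by (rule occ_carrier)
  have "(\<lambda>(s, m, s'). s \<otimes> m \<otimes> inv s') (t, m, inv a \<otimes> (t \<otimes> m)) \<in> Q"
    unfolding Q_def using t m a by (intro imageI) auto
  then have aQ: "a \<in> Q" using tc mc ac by (simp add: gsimps)
  then have "fails a \<in> fails ` Q \<union> breaks ` (F - N)" by simp
  then obtain C where C: "C \<subseteq> B0" "fails a C z0" using all by metis
  \<comment> \<open>The failure for this \<open>a\<close> is recorded inside \<open>B\<close>, where
    the marker of \<open>f z\<close> at \<open>a\<close> forces
    \<open>f z (a \<otimes> h) = z h\<close>.\<close>
  have "fails a C z" by (rule fails_cong[OF aQ C(2) B0(3) z_in_X]) (use Bz C in auto)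
  then obtain h where "h \<in> C" "f z (a \<otimes> h) \<noteq> z h" by (auto simp: fails_def)
  then show False using occ_match[OF a(1), of h] C(1) Bz(1) by auto
qed

text \<open>Equivariance moves the exceptional set around: two readings of one value show that
  commutators with \<open>a\<close> lie in \<open>N\<close>, and each cell can be read through an
  \<open>h\<close> outside \<open>E\<close>.\<close>

lemma commuting_is_lshift:
  assumes a: "a \<in> carrier G" and fin: "finite E" and f: "\<And>x. x \<in> X \<Longrightarrow> f x \<in> X"
    and equiv: "\<And>g x. g \<in> carrier G \<Longrightarrow> x \<in> X \<Longrightarrow> f (lshift G g x) = lshift G g (f x)"
    and shift: "\<And>x h. x \<in> X \<Longrightarrow> h \<in> carrier G \<Longrightarrow> h \<notin> E \<Longrightarrow> f x (a \<otimes> h) = x h"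
  shows "(\<forall>k\<in>carrier G. a \<otimes> k \<otimes> inv (k \<otimes> a) \<in> N) \<and> (\<forall>x\<in>X. f x = lshift G a x)"
proof -
  have tr: "f x (inv k \<otimes> (a \<otimes> h)) = x (inv k \<otimes> h)"
    if "x \<in> X" "k \<in> carrier G" "h \<in> carrier G" "h \<notin> E" for x k h
    using shift[OF lshift_in_X[OF that(2,1)] that(3,4)] that a equiv by (simp add: lshift_apply)
  have comm: "inv a \<otimes> (inv k \<otimes> (a \<otimes> k)) \<in> N" if k: "k \<in> carrier G" for k
  proof -
    define v where "v = inv a \<otimes> (inv k \<otimes> (a \<otimes> k))"
    have v: "v \<in> carrier G" using a k by (simp add: v_def)
    have "v \<in> N"
    proof (rule N_if_cofinitely_fixed[OF v])
      show "finite ((\<lambda>t. inv k \<otimes> t) ` E \<union> (\<lambda>t. inv v \<otimes> t) ` E)" using fin by simp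
      fix x t assume x: "x \<in> X" and t: "t \<in> carrier G"
        and tE: "t \<notin> (\<lambda>t. inv k \<otimes> t) ` E \<union> (\<lambda>t. inv v \<otimes> t) ` E"
      have 1: "k \<otimes> t \<notin> E"
      proof
        assume "k \<otimes> t \<in> E"
        then have "inv k \<otimes> (k \<otimes> t) \<in> (\<lambda>t. inv k \<otimes> t) ` E" by (rule imageI)
        then show False using tE k t by simp
      qed
      have 2: "v \<otimes> t \<notin> E"
      proof
        assume "v \<otimes> t \<in> E"
        then have "inv v \<otimes> (v \<otimes> t) \<in> (\<lambda>t. inv v \<otimes> t) ` E" by (rule imageI)
        then show False using tE v t by simp
      qed
      \<comment> \<open>One value of \<open>f x\<close> is read twice: by \<open>shift\<close> at
        \<open>a \<otimes> (v \<otimes> t)\<close>, and by \<open>tr\<close> at the same cell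
        written as \<open>inv k \<otimes> (a \<otimes> (k \<otimes> t))\<close>.\<close>
      have "x (v \<otimes> t) = f x (a \<otimes> (v \<otimes> t))" using shift[OF x _ 2] v t by simp
      also have "a \<otimes> (v \<otimes> t) = inv k \<otimes> (a \<otimes> (k \<otimes> t))"
        using a k t by (simp add: v_def m_assoc)
      also have "f x \<dots> = x t" using tr[OF x k _ 1] k t by simp
      finally show "x (v \<otimes> t) = x t" .
    qed
    then show ?thesis by (simp add: v_def)
  qed
  have comm': "w \<otimes> (inv a \<otimes> (inv w \<otimes> a)) \<in> N" if w: "w \<in> carrier G" for w
    using conj_in_N[OF w comm[OF w]] w a by (simp add: m_assoc)
  have "a \<otimes> k \<otimes> inv (k \<otimes> a) \<in> N" if k: "k \<in> carrier G" for k
    using conj_in_N[OF _ comm[OF k], of "k \<otimes> a"] k a by (simp add: gsimps)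
  moreover have "f x = lshift G a x" if x: "x \<in> X" for x
  proof (rule X_eqI)
    fix t assume t: "t \<in> carrier G"
    have "carrier G - E \<noteq> {}" using infinite_G fin by (metis Diff_infinite_finite finite.emptyI)
    then obtain h where h: "h \<in> carrier G" "h \<notin> E" by blast
    \<comment> \<open>Chosen so that \<open>inv k \<otimes> (a \<otimes> h) = t\<close> with
      \<open>h\<close> outside \<open>E\<close>.\<close>
    define k where "k = a \<otimes> (h \<otimes> inv t)"
    have k: "k \<in> carrier G" using a h t by (simp add: k_def)
    have "f x t = f x (inv k \<otimes> (a \<otimes> h))" using a h t by (simp add: k_def gsimps)
    also have "\<dots> = x (inv k \<otimes> h)" by (rule tr[OF x k h])
    also have "inv k \<otimes> h = (t \<otimes> inv h) \<otimes> (inv a \<otimes> (inv (t \<otimes> inv h) \<otimes> a)) \<otimes> (inv a \<otimes> t)"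
      using a h t by (simp add: k_def gsimps)
    also have "x \<dots> = x (inv a \<otimes> t)"
      by (rule N_apply[OF comm' x]) (use a h t in auto)
    finally show "f x t = lshift G a x t" using t by (simp add: lshift_apply)
  qed (use x f a lshift_in_X in auto)
  ultimately show ?thesis by blast
qed

end

section \<open>The center of the automorphism group\<close>

context shift_space
begin

abbreviation Aut where "Aut \<equiv> Aut_shift G A X"

lemma Aut_iff:
  "f \<in> carrier Aut \<longleftrightarrow> f \<in> Bij X \<and> homeomorphic_map TX TX f \<and>
     (\<forall>g\<in>carrier G. \<forall>x\<in>X. f (lshift G g x) = lshift G g (f x))"
  by (simp add: Aut_shift_def)

lemma Aut_in_X: "f \<in> carrier Aut \<Longrightarrow> x \<in> X \<Longrightarrow> f x \<in> X"
  by (auto simp: Aut_iff Bij_def bij_betw_def)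

lemma Aut_extensional: "f \<in> carrier Aut \<Longrightarrow> f \<in> extensional X"
  by (simp add: Aut_iff Bij_def)

lemma Aut_equivariant:
  "f \<in> carrier Aut \<Longrightarrow> g \<in> carrier G \<Longrightarrow> x \<in> X \<Longrightarrow> f (lshift G g x) = lshift G g (f x)"
  by (simp add: Aut_iff)

lemma Aut_mult:
  "f \<in> carrier Aut \<Longrightarrow> h \<in> carrier Aut \<Longrightarrow> f \<otimes>\<^bsub>Aut\<^esub> h = compose X f h"
  by (simp add: Aut_iff) (simp add: Aut_shift_def BijGroup_def)

lemma Aut_inverse:
  assumes f: "f \<in> carrier Aut"
  obtains h where "homeomorphic_maps TX TX f h" "\<forall>x\<in>X. h x \<in> X" "\<forall>x\<in>X. h (f x) = x" "\<forall>x\<in>X. f (h x) = x"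
    "\<forall>g\<in>carrier G. \<forall>x\<in>X. h (lshift G g x) = lshift G g (h x)"
proof -
  obtain h where h: "homeomorphic_maps TX TX f h"
    using f homeomorphic_map_maps unfolding Aut_iff by blast
  then have 1: "\<forall>x\<in>X. h x \<in> X" "\<forall>x\<in>X. h (f x) = x" "\<forall>x\<in>X. f (h x) = x"
    unfolding homeomorphic_maps_def topspace_TX
    using continuous_map_image_subset_topspace[of TX TX h] unfolding topspace_TX by blast+
  have "h (lshift G g x) = lshift G g (h x)" if "g \<in> carrier G" "x \<in> X" for g x
  proof -
    have "h (lshift G g (f (h x))) = h (f (lshift G g (h x)))"
      using Aut_equivariant[OF f] that 1 by simp
    then show ?thesis using that 1 lshift_in_X by simp
  qed
  then show thesis using that h 1 by blast
qed

lemma group_Aut: "group Aut"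
proof -
  have "subgroup (carrier Aut) (BijGroup X)"
  proof (rule group.subgroupI[OF group_BijGroup])
    show "carrier Aut \<subseteq> carrier (BijGroup X)" by (auto simp: Aut_iff BijGroup_def)
    have "restrict id X \<in> carrier Aut"
    proof -
      have "homeomorphic_map TX TX (restrict id X)"
        by (rule homeomorphic_map_eq[OF homeomorphic_map_id[THEN iffD2, OF refl]])
          (simp only: topspace_TX restrict_apply' id_apply)
      then show ?thesis
        using id_Bij[of X] lshift_in_X by (simp add: Aut_iff restrict_def id_def cong: if_cong)
    qed
    then show "carrier Aut \<noteq> {}" by blast
  next
    fix f assume f: "f \<in> carrier Aut"
    then have fB: "f \<in> Bij X" by (simp add: Aut_iff)
    obtain h where h: "homeomorphic_maps TX TX f h" "\<forall>x\<in>X. h x \<in> X" "\<forall>x\<in>X. h (f x) = x"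
      "\<forall>x\<in>X. f (h x) = x" "\<forall>g\<in>carrier G. \<forall>x\<in>X. h (lshift G g x) = lshift G g (h x)"
      using Aut_inverse[OF f] by metis
    \<comment> \<open>\<open>BijGroup\<close> inverts by \<open>inv_into\<close>; on
      \<open>X\<close> this is the homeomorphic inverse \<open>h\<close>.\<close>
    have eq: "(\<lambda>x\<in>X. inv_into X f x) = restrict h X"
    proof (rule restrict_ext)
      fix x assume x: "x \<in> X"
      have "inj_on f X" using fB by (simp add: Bij_def bij_betw_def)
      then have "inv_into X f (f (h x)) = h x" using h(2) x by (intro inv_into_f_f) auto
      then show "inv_into X f x = h x" using h(4) x by simp
    qed
    have "homeomorphic_map TX TX h" using h(1) homeomorphic_maps_sym homeomorphic_map_maps by metis
    then have "homeomorphic_map TX TX (restrict h X)"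
      by (rule homeomorphic_map_eq) (simp only: topspace_TX restrict_apply')
    moreover have "restrict h X \<in> Bij X"
      using restrict_inv_into_Bij[OF fB] by (simp add: eq)
    ultimately have "restrict h X \<in> carrier Aut"
      using h(5) lshift_in_X by (simp add: Aut_iff)
    then show "inv\<^bsub>BijGroup X\<^esub> f \<in> carrier Aut" using inv_BijGroup[OF fB] eq by simp
  next
    fix f h assume f: "f \<in> carrier Aut" and h: "h \<in> carrier Aut"
    have "homeomorphic_map TX TX (f \<circ> h)"
      by (rule homeomorphic_map_compose[of _ TX]) (use f h in \<open>simp_all add: Aut_iff\<close>)
    then have "homeomorphic_map TX TX (compose X f h)"
      by (rule homeomorphic_map_eq) (simp only: topspace_TX compose_def restrict_apply' o_apply)
    moreover have "compose X f h \<in> Bij X" using f h by (intro compose_Bij) (simp_all add: Aut_iff)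
    moreover have "\<forall>g\<in>carrier G. \<forall>x\<in>X. compose X f h (lshift G g x) = lshift G g (compose X f h x)"
      using Aut_equivariant[OF f] Aut_equivariant[OF h] Aut_in_X[OF h] lshift_in_X
      by (simp add: compose_def)
    ultimately have "compose X f h \<in> carrier Aut" by (simp add: Aut_iff)
    then show "f \<otimes>\<^bsub>BijGroup X\<^esub> h \<in> carrier Aut"
      using f h by (simp add: Aut_iff BijGroup_def)
  qed
  then have "group (BijGroup X \<lparr>carrier := carrier Aut\<rparr>)"
    by (rule subgroup.subgroup_is_group[OF _ group_BijGroup])
  moreover have "BijGroup X \<lparr>carrier := carrier Aut\<rparr> = Aut" by (simp add: Aut_shift_def)
  ultimately show ?thesis by simp
qed

lemma Aut_eqI:
  assumes "f \<in> carrier Aut" "h \<in> carrier Aut" "\<And>x. x \<in> X \<Longrightarrow> f x = h x"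
  shows "f = h"
  using assms Aut_extensional by (metis extensionalityI)

lemma Aut_mult_apply:
  "f \<in> carrier Aut \<Longrightarrow> h \<in> carrier Aut \<Longrightarrow> x \<in> X \<Longrightarrow> (f \<otimes>\<^bsub>Aut\<^esub> h) x = f (h x)"
  by (simp add: Aut_mult compose_def)

end

lemma (in group) subgroup_group_center: "subgroup (group_center G) G"
proof (rule subgroupI)
  show "group_center G \<subseteq> carrier G" by (auto simp: group_center_def)
  show "group_center G \<noteq> {}" by (auto simp: group_center_def intro!: exI[of _ \<one>])
next
  fix a assume a: "a \<in> group_center G"
  then have ac: "a \<in> carrier G" by (simp add: group_center_def)
  have "inv a \<otimes> y = y \<otimes> inv a" if y: "y \<in> carrier G" for y
  proof -
    have "a \<otimes> y = y \<otimes> a" using a y by (simp add: group_center_def)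
    then have "inv a \<otimes> (a \<otimes> y) \<otimes> inv a = inv a \<otimes> (y \<otimes> a) \<otimes> inv a" by simp
    then show ?thesis using ac y by (simp add: m_assoc flip: m_assoc[of "inv a" a])
  qed
  then show "inv a \<in> group_center G" using ac by (simp add: group_center_def)
next
  fix a b assume a: "a \<in> group_center G" and b: "b \<in> group_center G"
  then have ab: "a \<in> carrier G" "b \<in> carrier G" by (simp_all add: group_center_def)
  have "a \<otimes> b \<otimes> y = y \<otimes> (a \<otimes> b)" if y: "y \<in> carrier G" for y
  proof -
    have comm: "a \<otimes> y = y \<otimes> a" "b \<otimes> y = y \<otimes> b" using a b y by (simp_all add: group_center_def)
    have "a \<otimes> b \<otimes> y = a \<otimes> y \<otimes> b" using ab y comm(2) by (simp add: m_assoc)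
    then show ?thesis using ab y unfolding comm(1) by (simp add: m_assoc)
  qed
  then show "a \<otimes> b \<in> group_center G" using ab by (simp add: group_center_def)
qed

section \<open>Central cosets and their shifts\<close>

context shift_space
begin

lemma coset_eq_iff:
  assumes "a \<in> carrier G" "b \<in> carrier G"
  shows "N #> a = N #> b \<longleftrightarrow> a \<otimes> inv b \<in> N"
proof -
  have "N #> a = N #> b \<longleftrightarrow> a \<in> N #> b"
    using rcos_self[OF assms(1) subgroup_N] repr_independence[OF _ assms(2) subgroup_N, of a] by metis
  also have "\<dots> \<longleftrightarrow> a \<otimes> inv b \<in> N"
    using subgroup.rcos_module[OF subgroup_N is_group assms(2,1)] .
  finally show ?thesis .
qed

text \<open>The quotient by the kernel acts faithfully; this later makes \<open>\<Theta>\<close>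
  well defined and injective.\<close>

lemma coset_eq_iff_lshift:
  assumes a: "a \<in> carrier G" and b: "b \<in> carrier G"
  shows "N #> a = N #> b \<longleftrightarrow> (\<forall>x\<in>X. lshift G a x = lshift G b x)"
proof -
  have "a \<otimes> inv b \<in> N \<longleftrightarrow> (\<forall>x\<in>X. lshift G a (lshift G (inv b) x) = x)"
    using a b by (simp add: Fix_shift_def lshift_mult)
  also have "\<dots> \<longleftrightarrow> (\<forall>x\<in>X. lshift G a x = lshift G b x)"
  proof
    assume *: "\<forall>x\<in>X. lshift G a (lshift G (inv b) x) = x"
    show "\<forall>x\<in>X. lshift G a x = lshift G b x"
    proof
      fix x assume x: "x \<in> X"
      have "lshift G a (lshift G (inv b) (lshift G b x)) = lshift G b x"
        using * lshift_in_X[OF b x] by blast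
      then show "lshift G a x = lshift G b x" using lshift_inv_lshift[OF b x] by simp
    qed
  next
    assume *: "\<forall>x\<in>X. lshift G a x = lshift G b x"
    show "\<forall>x\<in>X. lshift G a (lshift G (inv b) x) = x"
      using * lshift_in_X[of "inv b"] lshift_lshift_inv[OF b] b by simp
  qed
  finally show ?thesis using coset_eq_iff[OF a b] by simp
qed

text \<open>Right cosets fit \<open>r_coset_hom_Mod\<close>; they equal the left cosets of the
  theorem because \<open>N\<close> is normal.\<close>

definition central_lifts :: "'g set" where
  "central_lifts = {g \<in> carrier G. N #> g \<in> group_center (G Mod N)}"

lemma central_lifts_carrier: "g \<in> central_lifts \<Longrightarrow> g \<in> carrier G" by (simp add: central_lifts_def)

lemma lcoset_eq_rcoset: "g \<in> carrier G \<Longrightarrow> g <# N = N #> g"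
  using normal.coset_eq[OF normal_N] by simp

lemma carrier_Mod: "carrier (G Mod N) = (\<lambda>g. N #> g) ` carrier G"
  by (auto simp: FactGroup_def RCOSETS_def)

lemma mult_Mod: "a \<in> carrier G \<Longrightarrow> b \<in> carrier G \<Longrightarrow> (N #> a) <#> (N #> b) = N #> (a \<otimes> b)"
  by (rule normal.rcos_sum[OF normal_N])

lemma central_lifts_iff: "a \<in> central_lifts \<longleftrightarrow> a \<in> carrier G \<and> (\<forall>k\<in>carrier G. a \<otimes> k \<otimes> inv (k \<otimes> a) \<in> N)"
proof -
  have "N #> a \<in> group_center (G Mod N) \<longleftrightarrow> (\<forall>k\<in>carrier G. N #> (a \<otimes> k) = N #> (k \<otimes> a))"
    if "a \<in> carrier G"
    using that by (auto simp: group_center_def carrier_Mod mult_Mod)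
  then show ?thesis using coset_eq_iff by (auto simp: central_lifts_def)
qed

lemma central_lifts_commute:
  assumes "a \<in> central_lifts" "k \<in> carrier G" "x \<in> X"
  shows "lshift G a (lshift G k x) = lshift G k (lshift G a x)"
proof -
  have a: "a \<in> carrier G" using assms(1) by (rule central_lifts_carrier)
  have "a \<otimes> k \<otimes> inv (k \<otimes> a) \<in> N" using assms central_lifts_iff by blast
  then have "N #> (a \<otimes> k) = N #> (k \<otimes> a)" using coset_eq_iff a assms(2) by simp
  then have "lshift G (a \<otimes> k) x = lshift G (k \<otimes> a) x"
    using coset_eq_iff_lshift a assms(2,3) by simp
  then show ?thesis using a assms(2) by (simp add: lshift_mult)
qed

lemma subgroup_central_lifts: "subgroup central_lifts G"
proof -
  interpret M: group "G Mod N" using normal.factorgroup_is_group[OF normal_N] .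
  have hom: "(\<lambda>g. N #> g) \<in> hom G (G Mod N)"
    using normal.r_coset_hom_Mod[OF normal_N] .
  interpret h: group_hom G "G Mod N" "\<lambda>g. N #> g"
    by unfold_locales (rule hom)
  have Z: "subgroup (group_center (G Mod N)) (G Mod N)" by (rule M.subgroup_group_center)
  show ?thesis
  proof (rule subgroupI)
    show "central_lifts \<subseteq> carrier G" by (auto simp: central_lifts_def)
    have "\<one> \<in> central_lifts" using subgroup.one_closed[OF Z] h.hom_one by (simp add: central_lifts_def)
    then show "central_lifts \<noteq> {}" by blast
    show "inv a \<in> central_lifts" if "a \<in> central_lifts" for a
      using that subgroup.m_inv_closed[OF Z, of "N #> a"] h.hom_inv[of a] by (simp add: central_lifts_def)
    show "a \<otimes> b \<in> central_lifts" if "a \<in> central_lifts" "b \<in> central_lifts" for a b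
    proof -
      note ab = central_lifts_carrier[OF that(1)] central_lifts_carrier[OF that(2)]
      have "(N #> a) \<otimes>\<^bsub>G Mod N\<^esub> (N #> b) \<in> group_center (G Mod N)"
        using that by (intro subgroup.m_closed[OF Z]) (simp_all add: central_lifts_def)
      then have "N #> (a \<otimes> b) \<in> group_center (G Mod N)"
        by (simp only: mult_FactGroup mult_Mod[OF ab])
      then show ?thesis by (simp only: central_lifts_def mem_Collect_eq m_closed[OF ab] simp_thms)
    qed
  qed
qed

definition lshift_on :: "'g \<Rightarrow> ('g \<Rightarrow> 'a) \<Rightarrow> 'g \<Rightarrow> 'a" where
  "lshift_on g = restrict (lshift G g) X"

lemma lshift_on_apply: "x \<in> X \<Longrightarrow> lshift_on g x = lshift G g x"
  by (simp add: lshift_on_def)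

text \<open>Centrality modulo \<open>N\<close> is what makes a left shift equivariant; its inverse
  is the shift by \<open>inv a\<close>.\<close>

lemma lshift_on_Aut:
  assumes "a \<in> central_lifts" shows "lshift_on a \<in> carrier Aut"
proof -
  have a: "a \<in> carrier G" using assms by (rule central_lifts_carrier)
  have cont: "continuous_map TX TX (lshift G b)" if b: "b \<in> carrier G" for b
  proof (rule continuous_mapI_local)
    show "lshift G b \<in> X \<rightarrow> X" using lshift_in_X[OF b] by blast
    fix x t assume "x \<in> X" "t \<in> carrier G"
    then show "\<exists>W. finite W \<and> W \<subseteq> carrier G \<and> (\<forall>y\<in>X. (\<forall>s\<in>W. y s = x s) \<longrightarrow> lshift G b y t = lshift G b x t)"
      using b by (intro exI[of _ "{inv b \<otimes> t}"]) (simp add: lshift_apply)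
  qed
  have "homeomorphic_maps TX TX (lshift G a) (lshift G (inv a))"
    unfolding homeomorphic_maps_def topspace_TX
    using cont a lshift_inv_lshift lshift_lshift_inv by simp
  then have "homeomorphic_map TX TX (lshift G a)" using homeomorphic_map_maps by blast
  then have "homeomorphic_map TX TX (lshift_on a)"
    by (rule homeomorphic_map_eq) (simp only: topspace_TX lshift_on_apply)
  moreover have "bij_betw (lshift_on a) X X"
    by (rule bij_betw_byWitness[where f' = "lshift_on (inv a)"])
      (use a lshift_in_X lshift_inv_lshift lshift_lshift_inv in \<open>auto simp: lshift_on_apply\<close>)
  then have "lshift_on a \<in> Bij X" by (simp add: Bij_def lshift_on_def)
  ultimately show ?thesis
    using central_lifts_commute[OF assms] lshift_in_X a by (simp add: Aut_iff lshift_on_apply)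
qed

lemma lshift_on_center:
  assumes "a \<in> central_lifts" shows "lshift_on a \<in> group_center Aut"
proof -
  have a: "a \<in> carrier G" using assms by (rule central_lifts_carrier)
  interpret Au: group Aut by (rule group_Aut)
  have "lshift_on a \<otimes>\<^bsub>Aut\<^esub> f = f \<otimes>\<^bsub>Aut\<^esub> lshift_on a" if f: "f \<in> carrier Aut" for f
  proof (rule Aut_eqI)
    fix x assume x: "x \<in> X"
    then show "(lshift_on a \<otimes>\<^bsub>Aut\<^esub> f) x = (f \<otimes>\<^bsub>Aut\<^esub> lshift_on a) x"
      using f lshift_on_Aut[OF assms] Aut_equivariant[OF f a x] Aut_in_X[OF f x]
      by (simp add: Aut_mult_apply lshift_on_apply)
  qed (use f lshift_on_Aut[OF assms] in auto)
  then show ?thesis using lshift_on_Aut[OF assms] by (simp add: group_center_def)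
qed

lemma lshift_on_mult:
  assumes "a \<in> central_lifts" "b \<in> central_lifts"
  shows "lshift_on a \<otimes>\<^bsub>Aut\<^esub> lshift_on b = lshift_on (a \<otimes> b)"
proof (rule Aut_eqI)
  interpret Au: group Aut by (rule group_Aut)
  show "lshift_on a \<otimes>\<^bsub>Aut\<^esub> lshift_on b \<in> carrier Aut" using assms lshift_on_Aut by simp
  show "lshift_on (a \<otimes> b) \<in> carrier Aut" using assms subgroup.m_closed[OF subgroup_central_lifts] lshift_on_Aut by blast
  fix x assume x: "x \<in> X"
  show "(lshift_on a \<otimes>\<^bsub>Aut\<^esub> lshift_on b) x = lshift_on (a \<otimes> b) x"
    using x assms lshift_on_Aut central_lifts_carrier lshift_in_X by (simp add: Aut_mult_apply lshift_on_apply lshift_mult)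
qed

text \<open>\<open>a \<otimes> h\<close> and \<open>h \<otimes> a\<close> differ by a left factor in
  \<open>N\<close>, which \<open>x\<close> does not see.\<close>

lemma rshift_eq_lshift_inv:
  assumes a: "a \<in> central_lifts" and x: "x \<in> X"
  shows "rshift G a x = lshift G (inv a) x"
proof -
  have ac: "a \<in> carrier G" using a by (rule central_lifts_carrier)
  have "x (h \<otimes> a) = x (a \<otimes> h)" if h: "h \<in> carrier G" for h
  proof -
    have "a \<otimes> h \<otimes> inv (h \<otimes> a) \<in> N" using a h central_lifts_iff by blast
    then have "x (a \<otimes> h \<otimes> inv (h \<otimes> a) \<otimes> (h \<otimes> a)) = x (h \<otimes> a)" using h ac x by (intro N_apply) auto
    then show ?thesis using h ac by (simp add: m_assoc)
  qed
  then show ?thesis using ac by (auto simp: rshift_def lshift_def intro!: restrict_ext)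
qed

lemma lshift_on_eq_iff:
  assumes "a \<in> carrier G" "b \<in> carrier G"
  shows "lshift_on a = lshift_on b \<longleftrightarrow> N #> a = N #> b"
proof -
  have "lshift_on a = lshift_on b \<longleftrightarrow> (\<forall>x\<in>X. lshift G a x = lshift G b x)"
    unfolding lshift_on_def by (metis restrict_apply' restrict_ext)
  then show ?thesis using coset_eq_iff_lshift[OF assms] by simp
qed

text \<open>All dynamics is in \<open>key\<close>; the rest is algebra. The shifts by central lifts
  already form a group, so generating adds nothing.\<close>

lemma center_theorem:
  assumes key: "\<And>f. f \<in> group_center Aut \<Longrightarrow> \<exists>a\<in>central_lifts. \<forall>x\<in>X. f x = lshift G a x"
  shows "group_center Aut = generate Aut {restrict (rshift G g) X | g.
                g \<in> carrier G \<and> g <# N \<in> group_center (G Mod N)}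
       \<and> Aut\<lparr>carrier := group_center Aut\<rparr> \<cong> (G Mod N)\<lparr>carrier := group_center (G Mod N)\<rparr>"
proof
  interpret Au: group Aut by (rule group_Aut)
  have center: "group_center Aut = lshift_on ` central_lifts"
  proof
    show "group_center Aut \<subseteq> lshift_on ` central_lifts"
    proof
      fix f assume f: "f \<in> group_center Aut"
      then have fA: "f \<in> carrier Aut" by (simp add: group_center_def)
      obtain a where a: "a \<in> central_lifts" "\<forall>x\<in>X. f x = lshift G a x" using key[OF f] by blast
      have "f = lshift_on a" by (rule Aut_eqI[OF fA lshift_on_Aut[OF a(1)]]) (use a in \<open>simp add: lshift_on_apply\<close>)
      then show "f \<in> lshift_on ` central_lifts" using a by blast
    qed
  qed (use lshift_on_center in blast)
  let ?R = "{restrict (rshift G g) X | g. g \<in> carrier G \<and> g <# N \<in> group_center (G Mod N)}"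
  have "?R = (\<lambda>g. restrict (rshift G g) X) ` central_lifts"
    by (auto simp: central_lifts_def lcoset_eq_rcoset)
  \<comment> \<open>Right shifts are left shifts by inverses, and inversion permutes
    \<open>central_lifts\<close>.\<close>
  also have "\<dots> = (\<lambda>g. lshift_on (inv g)) ` central_lifts"
    using rshift_eq_lshift_inv by (intro image_cong refl) (auto simp: lshift_on_def intro!: restrict_ext)
  also have "\<dots> = lshift_on ` central_lifts"
  proof
    show "(\<lambda>g. lshift_on (inv g)) ` central_lifts \<subseteq> lshift_on ` central_lifts" using subgroup.m_inv_closed[OF subgroup_central_lifts] by auto
    show "lshift_on ` central_lifts \<subseteq> (\<lambda>g. lshift_on (inv g)) ` central_lifts"
    proof
      fix f assume "f \<in> lshift_on ` central_lifts"
      then obtain a where a: "a \<in> central_lifts" "f = lshift_on a" by blast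
      show "f \<in> (\<lambda>g. lshift_on (inv g)) ` central_lifts"
        by (rule image_eqI[where x = "inv a"])
          (use a subgroup.m_inv_closed[OF subgroup_central_lifts a(1)] central_lifts_carrier in simp_all)
    qed
  qed
  finally have R: "?R = group_center Aut" using center by simp
  have sub: "subgroup (group_center Aut) Aut" by (rule Au.subgroup_group_center)
  show "group_center Aut = generate Aut ?R"
  proof
    show "generate Aut ?R \<subseteq> group_center Aut"
      by (rule Au.generate_subgroup_incl[OF _ sub]) (simp add: R)
    show "group_center Aut \<subseteq> generate Aut ?R"
      using R by (auto intro: generate.incl)
  qed
  define \<Theta> where "\<Theta> f = N #> (SOME a. a \<in> central_lifts \<and> f = lshift_on a)" for f
  have \<Theta>: "\<Theta> (lshift_on a) = N #> a" if a: "a \<in> central_lifts" for a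
  proof -
    define b where "b = (SOME b. b \<in> central_lifts \<and> lshift_on a = lshift_on b)"
    have b: "b \<in> central_lifts" "lshift_on a = lshift_on b"
      using someI[of "\<lambda>b. b \<in> central_lifts \<and> lshift_on a = lshift_on b" a] a unfolding b_def by auto
    then have "N #> a = N #> b" using lshift_on_eq_iff a central_lifts_carrier by metis
    then show ?thesis by (simp add: \<Theta>_def b_def)
  qed
  have cosets: "group_center (G Mod N) = (\<lambda>a. N #> a) ` central_lifts"
    by (auto simp: central_lifts_def group_center_def carrier_Mod)
  have "\<Theta> \<in> iso (Aut\<lparr>carrier := group_center Aut\<rparr>) ((G Mod N)\<lparr>carrier := group_center (G Mod N)\<rparr>)"
    unfolding iso_def
  proof (intro CollectI conjI homI)
    show "\<Theta> f \<in> carrier ((G Mod N)\<lparr>carrier := group_center (G Mod N)\<rparr>)"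
      if "f \<in> carrier (Aut\<lparr>carrier := group_center Aut\<rparr>)" for f
      using that \<Theta> by (auto simp: center cosets)
    show "\<Theta> (f \<otimes>\<^bsub>Aut\<lparr>carrier := group_center Aut\<rparr>\<^esub> h) =
        \<Theta> f \<otimes>\<^bsub>(G Mod N)\<lparr>carrier := group_center (G Mod N)\<rparr>\<^esub> \<Theta> h"
      if fh: "f \<in> carrier (Aut\<lparr>carrier := group_center Aut\<rparr>)" "h \<in> carrier (Aut\<lparr>carrier := group_center Aut\<rparr>)"
      for f h
    proof -
      obtain a b where ab: "a \<in> central_lifts" "b \<in> central_lifts" "f = lshift_on a" "h = lshift_on b" using fh by (auto simp: center)
      then show ?thesis
        using \<Theta> lshift_on_mult subgroup.m_closed[OF subgroup_central_lifts] central_lifts_carrier by (simp add: mult_Mod)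
    qed
    have "inj_on \<Theta> (lshift_on ` central_lifts)"
    proof (rule inj_onI)
      fix f h assume "f \<in> lshift_on ` central_lifts" "h \<in> lshift_on ` central_lifts" and eq: "\<Theta> f = \<Theta> h"
      then obtain a b where ab: "a \<in> central_lifts" "b \<in> central_lifts" "f = lshift_on a" "h = lshift_on b" by blast
      then show "f = h" using eq \<Theta> lshift_on_eq_iff[of a b] central_lifts_carrier by simp
    qed
    moreover have "\<Theta> ` lshift_on ` central_lifts = (\<lambda>a. N #> a) ` central_lifts" using \<Theta> by (auto simp: image_image)
    ultimately show "bij_betw \<Theta> (carrier (Aut\<lparr>carrier := group_center Aut\<rparr>))
        (carrier ((G Mod N)\<lparr>carrier := group_center (G Mod N)\<rparr>))"
      by (simp add: bij_betw_def center cosets)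
  qed
  then show "Aut\<lparr>carrier := group_center Aut\<rparr> \<cong> (G Mod N)\<lparr>carrier := group_center (G Mod N)\<rparr>"
    unfolding is_iso_def by blast
qed

end

text \<open>Both memory sets are needed: that of \<open>f\<close> makes failures local, that of its
  inverse bounds the candidate displacements.\<close>

lemma (in si_shift) center_is_lshift:
  assumes f: "f \<in> group_center Aut"
  shows "\<exists>a\<in>central_lifts. \<forall>x\<in>X. f x = lshift G a x"
proof -
  have fA: "f \<in> carrier Aut" using f by (simp add: group_center_def)
  have fX: "f x \<in> X" if "x \<in> X" for x using Aut_in_X[OF fA that] .
  obtain h where h: "homeomorphic_maps TX TX f h" "\<forall>x\<in>X. h x \<in> X" "\<forall>x\<in>X. h (f x) = x"
    "\<forall>x\<in>X. f (h x) = x" "\<forall>g\<in>carrier G. \<forall>x\<in>X. h (lshift G g x) = lshift G g (h x)"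
    using Aut_inverse[OF fA] by metis
  have cont: "continuous_map TX TX f" "continuous_map TX TX h"
    using h(1) by (simp_all add: homeomorphic_maps_def)
  obtain M where M: "finite M" "M \<subseteq> carrier G"
    "\<forall>x\<in>X. \<forall>y\<in>X. \<forall>t\<in>carrier G. (\<forall>m\<in>M. x (t \<otimes> m) = y (t \<otimes> m)) \<longrightarrow> f x t = f y t"
    using memory_set[OF cont(1)] Aut_equivariant[OF fA] by (metis (no_types, lifting))
  obtain M' where M': "finite M'" "M' \<subseteq> carrier G"
    "\<forall>x\<in>X. \<forall>y\<in>X. \<forall>t\<in>carrier G. (\<forall>m\<in>M'. x (t \<otimes> m) = y (t \<otimes> m)) \<longrightarrow> h x t = h y t"
    using memory_set[OF cont(2)] h(5) by (metis (no_types, lifting))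
  have "\<exists>a\<in>carrier G. finite {t \<in> carrier G. \<exists>x\<in>X. f x (a \<otimes> t) \<noteq> x t}"
  proof (rule commuting_is_cofinitely_lshift[of f h M M'])
    show "f (\<phi> x) = \<phi> (f x)" if "\<phi> \<in> carrier Aut" "x \<in> X" for \<phi> x
    proof -
      have "f \<otimes>\<^bsub>Aut\<^esub> \<phi> = \<phi> \<otimes>\<^bsub>Aut\<^esub> f" using f that by (simp add: group_center_def)
      then show ?thesis using that fA Aut_mult_apply by metis
    qed
    show "f x t = f y t"
      if "x \<in> X" "y \<in> X" "t \<in> carrier G" "\<And>m. m \<in> M \<Longrightarrow> x (t \<otimes> m) = y (t \<otimes> m)" for x y t
      using M(3)[THEN bspec, OF that(1), THEN bspec, OF that(2), THEN bspec, OF that(3)] that(4) by simp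
    show "h x t = h y t"
      if "x \<in> X" "y \<in> X" "t \<in> carrier G" "\<And>m. m \<in> M' \<Longrightarrow> x (t \<otimes> m) = y (t \<otimes> m)" for x y t
      using M'(3)[THEN bspec, OF that(1), THEN bspec, OF that(2), THEN bspec, OF that(3)] that(4) by simp
    show "f x \<in> X" "h (f x) = x" if "x \<in> X" for x
      using fX h(3) that by simp_all
  qed (fact M(1,2) M'(1,2))+
  then obtain a where a: "a \<in> carrier G" "finite {t \<in> carrier G. \<exists>x\<in>X. f x (a \<otimes> t) \<noteq> x t}" by blast
  have "(\<forall>k\<in>carrier G. a \<otimes> k \<otimes> inv (k \<otimes> a) \<in> N) \<and> (\<forall>x\<in>X. f x = lshift G a x)"
    by (rule commuting_is_lshift[OF a]) (use fX Aut_equivariant[OF fA] in auto)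
  then show ?thesis using a(1) central_lifts_iff by blast
qed

text \<open>Adjoining \<open>\<one>\<close> to the constant only strengthens the separation required
  of \<open>P\<close> and \<open>T\<close>.\<close>

lemma strongly_irreducible_glue:
  assumes "group G" "strongly_irreducible G X"
  obtains K where "finite K" "K \<subseteq> carrier G" "\<one>\<^bsub>G\<^esub> \<in> K"
    "\<forall>P T. finite P \<and> P \<subseteq> carrier G \<and> finite T \<and> T \<subseteq> carrier G \<and> (\<forall>s\<in>P. \<forall>k\<in>K. s \<otimes>\<^bsub>G\<^esub> k \<notin> T) \<longrightarrow>
      (\<forall>x\<in>X. \<forall>y\<in>X. \<exists>z\<in>X. (\<forall>t\<in>P. z t = x t) \<and> (\<forall>t\<in>T. z t = y t))"
proof -
  obtain K where K: "finite K" "K \<subseteq> carrier G"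
    and si: "\<forall>S T. finite S \<and> S \<subseteq> carrier G \<and> finite T \<and> T \<subseteq> carrier G \<and>
               (S <#>\<^bsub>G\<^esub> K) \<inter> T = {} \<longrightarrow>
           (\<forall>p\<in>patterns S X. \<forall>q\<in>patterns T X.
              \<exists>x\<in>X. restrict x S = p \<and> restrict x T = q)"
    using assms(2) unfolding strongly_irreducible_def by (elim exE conjE)
  show thesis
  proof (rule that[of "insert \<one>\<^bsub>G\<^esub> K"])
    show "\<forall>P T. finite P \<and> P \<subseteq> carrier G \<and> finite T \<and> T \<subseteq> carrier G \<and>
      (\<forall>s\<in>P. \<forall>k\<in>insert \<one>\<^bsub>G\<^esub> K. s \<otimes>\<^bsub>G\<^esub> k \<notin> T) \<longrightarrow>
      (\<forall>x\<in>X. \<forall>y\<in>X. \<exists>z\<in>X. (\<forall>t\<in>P. z t = x t) \<and> (\<forall>t\<in>T. z t = y t))"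
    proof (intro allI impI ballI)
      fix P T x y
      assume *: "finite P \<and> P \<subseteq> carrier G \<and> finite T \<and> T \<subseteq> carrier G \<and>
          (\<forall>s\<in>P. \<forall>k\<in>insert \<one>\<^bsub>G\<^esub> K. s \<otimes>\<^bsub>G\<^esub> k \<notin> T)"
        and x: "x \<in> X" and y: "y \<in> X"
      have "finite P \<and> P \<subseteq> carrier G \<and> finite T \<and> T \<subseteq> carrier G \<and> (P <#>\<^bsub>G\<^esub> K) \<inter> T = {}"
        using * by (auto simp: set_mult_def)
      then have "\<forall>p\<in>patterns P X. \<forall>q\<in>patterns T X. \<exists>x\<in>X. restrict x P = p \<and> restrict x T = q"
        by (rule si[THEN spec, THEN spec, THEN mp])
      moreover have "restrict x P \<in> patterns P X" "restrict y T \<in> patterns T X"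
        using x y by (auto simp: patterns_def)
      ultimately obtain z where z: "z \<in> X" "restrict z P = restrict x P" "restrict z T = restrict y T"
        by blast
      then show "\<exists>z\<in>X. (\<forall>t\<in>P. z t = x t) \<and> (\<forall>t\<in>T. z t = y t)"
        by (intro bexI[of _ z]) (metis restrict_apply')
    qed
  qed (use K group.is_monoid[OF assms(1)] in \<open>auto intro: monoid.one_closed\<close>)
qed

theorem theorem1:
  fixes G :: "('g, 'm) monoid_scheme" and A :: "'a set" and X :: "('g \<Rightarrow> 'a) set"
  assumes "group G" and "infinite (carrier G)"
    and "finite A" and "subshift G A X"
    and "X \<noteq> {}" and "strongly_irreducible G X"
  shows "group_center (Aut_shift G A X) =
           generate (Aut_shift G A X)
             {restrict (rshift G g) X | g.
                g \<in> carrier G \<and>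
                g <#\<^bsub>G\<^esub> Fix_shift G X \<in> group_center (G Mod Fix_shift G X)}
       \<and> (Aut_shift G A X)\<lparr>carrier := group_center (Aut_shift G A X)\<rparr> \<cong>
         (G Mod Fix_shift G X)\<lparr>carrier := group_center (G Mod Fix_shift G X)\<rparr>"
proof -
  interpret group G by (rule assms(1))
  interpret shift_space G A X by unfold_locales (use assms in auto)
  show ?thesis
  proof (rule center_theorem)
    fix f assume f: "f \<in> group_center (Aut_shift G A X)"
    show "\<exists>a\<in>central_lifts. \<forall>x\<in>X. f x = lshift G a x"
    proof (cases "\<exists>x\<in>X. \<exists>y\<in>X. x \<noteq> y")
      case True
      obtain K where K: "finite K" "K \<subseteq> carrier G" "\<one>\<^bsub>G\<^esub> \<in> K"
        "\<forall>P T. finite P \<and> P \<subseteq> carrier G \<and> finite T \<and> T \<subseteq> carrier G \<and> (\<forall>s\<in>P. \<forall>k\<in>K. s \<otimes>\<^bsub>G\<^esub> k \<notin> T) \<longrightarrow>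
          (\<forall>x\<in>X. \<forall>y\<in>X. \<exists>z\<in>X. (\<forall>t\<in>P. z t = x t) \<and> (\<forall>t\<in>T. z t = y t))"
        by (rule strongly_irreducible_glue[OF assms(1,6)])
      interpret si_shift G A X K
      proof unfold_locales
        fix P T :: "'g set" and x y
        assume "finite P" "P \<subseteq> carrier G" "finite T" "T \<subseteq> carrier G"
          "\<And>s k. s \<in> P \<Longrightarrow> k \<in> K \<Longrightarrow> s \<otimes>\<^bsub>G\<^esub> k \<notin> T" and xy: "x \<in> X" "y \<in> X"
        then show "\<exists>z\<in>X. (\<forall>t\<in>P. z t = x t) \<and> (\<forall>t\<in>T. z t = y t)"
          using K(4)[THEN spec, THEN spec, THEN mp, of P T] by blast
      qed (use K assms True in auto)
      show ?thesis by (rule center_is_lshift[OF f])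
    next
      case False
      have fA: "f \<in> carrier (Aut_shift G A X)" using f by (simp add: group_center_def)
      \<comment> \<open>With a single point, \<open>f\<close> is the identity, that is, the shift by
        the neutral element.\<close>
      have "f x = lshift G \<one>\<^bsub>G\<^esub> x" if "x \<in> X" for x
        using False that Aut_in_X[OF fA that] lshift_in_X[of "\<one>\<^bsub>G\<^esub>" x] by auto
      moreover have "\<one>\<^bsub>G\<^esub> \<in> central_lifts" by (rule subgroup.one_closed[OF subgroup_central_lifts])
      ultimately show ?thesis by blast
    qed
  qed
qed

end
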